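(* A smooth spacetime $M$ is strongly causal if and only if its ordered locale $(\mathrm{Loc}(M),\trianglelefteq)$ is convex.
   Context: A smooth spacetime is a connected Lorentzian manifold $(M,g)$ of dimension $\geq 2$ (signature $(-+\cdots+)$) with a time orientation. A nonzero tangent vector $v$ is causal if $g(v,v)\leq 0$. A causal curve is a piecewise $C^1$ curve all of whose tangent vectors are causal and future directed. $x\preccurlyeq y$ means $x=y$ or there is a causal curve from $x$ to $y$. For $A\subseteq M$: $J^+(A)=\{y:\exists x\in A,\ x\preccurlyeq y\}$, $J^-(A)=\{y:\exists x\in A,\ y\preccurlyeq x\}$. $M$ is strongly causal if for every $x\in M$ and every open neighbourhood $V$ of $x$ there is an open $U$ with $x\in U\subseteq V$ which is causally convex, i.e. $a,b\in U$ and $a\preccurlyeq z\preccurlyeq b$ imply $z\in U$. $\mathrm{Loc}(M)$ is the locale whose frame is the frame $\mathcal{O}M$ of open sets of the manifold topology, equipped with the preorder $U\trianglelefteq V$ iff $U\subseteq J^-(V)$ and $V\subseteq J^+(U)$. Its localic cones are $\Uparrow U=\bigcup\{V\in\mathcal{O}M: U\trianglelefteq V\}$ and $\Downarrow U=\bigcup\{W\in\mathcal{O}M: W\trianglelefteq U\}$. The ordered locale is convex if the open sets $U$ with $U=\Uparrow U\cap\Downarrow U$ form a base of $\mathcal{O}M$; equivalently, every open set is a union of sets of the form $\Uparrow V\cap\Downarrow W$ with $V,W$ open. *)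

theory Defs
  imports "HOL-Analysis.Analysis"
begin

section \<open>Smooth maps between Euclidean spaces\<close>

text \<open>\<open>Ck_on k f S\<close> is meant for open \<open>S\<close>: all iterated directional derivatives of \<open>f\<close> of order
  up to \<open>k\<close> exist and are continuous on \<open>S\<close>.\<close>

primrec Ck_on ::
  "nat \<Rightarrow> ('e::euclidean_space \<Rightarrow> 'f::real_normed_vector) \<Rightarrow> 'e set \<Rightarrow> bool" where
  "Ck_on 0 f S \<longleftrightarrow> continuous_on S f"
| "Ck_on (Suc k) f S \<longleftrightarrow>
     (\<forall>x\<in>S. f differentiable (at x)) \<and> (\<forall>v. Ck_on k (\<lambda>x. frechet_derivative f (at x) v) S)"

definition smooth_on :: "('e::euclidean_space \<Rightarrow> 'f::real_normed_vector) \<Rightarrow> 'e set \<Rightarrow> bool" where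
  "smooth_on f S \<longleftrightarrow> (\<forall>k. Ck_on k f S)"


section \<open>Smooth manifolds\<close>

text \<open>A chart \<open>(U, \<phi>)\<close> consists of its domain and its coordinate map; values of \<open>\<phi>\<close> outside \<open>U\<close> are
  irrelevant.\<close>

type_synonym ('a, 'e) chart = "'a set \<times> ('a \<Rightarrow> 'e)"

abbreviation dom_chart :: "('a, 'e) chart \<Rightarrow> 'a set" where
  "dom_chart c \<equiv> fst c"

abbreviation coord :: "('a, 'e) chart \<Rightarrow> 'a \<Rightarrow> 'e" where
  "coord c \<equiv> snd c"

definition chart_inv :: "('a, 'e) chart \<Rightarrow> 'e \<Rightarrow> 'a" where
  "chart_inv c = inv_into (dom_chart c) (coord c)"

definition transition :: "('a, 'e) chart \<Rightarrow> ('a, 'e) chart \<Rightarrow> 'e \<Rightarrow> 'e" where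
  "transition c d = coord d \<circ> chart_inv c"

text \<open>The manifold is the set \<open>topspace X\<close>, its manifold topology is \<open>X\<close>, and the smooth structure is
  the one generated by the (not necessarily maximal) smooth atlas \<open>A\<close>.\<close>

locale smooth_manifold =
  fixes X :: "'a topology"
    and A :: "('a, 'e::euclidean_space) chart set"
  assumes Hausdorff: "Hausdorff_space X"
    and second_countable: "second_countable X"
    and chart_cover: "topspace X = (\<Union>c\<in>A. dom_chart c)"
    and chart_open: "\<And>c. c \<in> A \<Longrightarrow> openin X (dom_chart c)"
    and chart_image_open: "\<And>c. c \<in> A \<Longrightarrow> open (coord c ` dom_chart c)"
    and chart_homeo: "\<And>c. c \<in> A \<Longrightarrow>
      homeomorphic_map (subtopology X (dom_chart c)) (top_of_set (coord c ` dom_chart c)) (coord c)"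
    and chart_compatible: "\<And>c d. c \<in> A \<Longrightarrow> d \<in> A \<Longrightarrow>
      smooth_on (transition c d) (coord c ` (dom_chart c \<inter> dom_chart d))"
begin

text \<open>A tangent vector at \<open>p\<close> is the family of its components in the charts around \<open>p\<close>, related by
  the Jacobians of the transition maps; it is extended by \<open>0\<close> to the remaining indices so that
  equality of tangent vectors is equality of functions.\<close>

definition tangent_space :: "'a \<Rightarrow> (('a, 'e) chart \<Rightarrow> 'e) set" where
  "tangent_space p = {v.
     (\<forall>c\<in>A. \<forall>d\<in>A. p \<in> dom_chart c \<inter> dom_chart d \<longrightarrow>
        v d = frechet_derivative (transition c d) (at (coord c p)) (v c)) \<and>
     (\<forall>c. \<not> (c \<in> A \<and> p \<in> dom_chart c) \<longrightarrow> v c = 0)}"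

text \<open>The tangent vector at \<open>p\<close> whose components in the chart \<open>c\<close> around \<open>p\<close> are \<open>u\<close>. For fixed
  \<open>c\<close> and \<open>p\<close> this is the isomorphism from the model space onto the tangent space at \<open>p\<close>.\<close>

definition chart_vector :: "('a, 'e) chart \<Rightarrow> 'a \<Rightarrow> 'e \<Rightarrow> (('a, 'e) chart \<Rightarrow> 'e)" where
  "chart_vector c p u = (\<lambda>d. if d \<in> A \<and> p \<in> dom_chart d
     then frechet_derivative (transition c d) (at (coord c p)) u else 0)"

text \<open>The velocity at \<open>t\<close> of a curve defined on the interval \<open>I\<close>; it is one-sided at the
  end points of \<open>I\<close>.\<close>

definition velocity :: "(real \<Rightarrow> 'a) \<Rightarrow> real set \<Rightarrow> real \<Rightarrow> (('a, 'e) chart \<Rightarrow> 'e)" where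
  "velocity \<gamma> I t = (\<lambda>c. if c \<in> A \<and> \<gamma> t \<in> dom_chart c
     then vector_derivative (coord c \<circ> \<gamma>) (at t within I) else 0)"

definition C1_curve :: "(real \<Rightarrow> 'a) \<Rightarrow> real \<Rightarrow> real \<Rightarrow> bool" where
  "C1_curve \<gamma> a b \<longleftrightarrow> a < b \<and> continuous_map (top_of_set {a..b}) X \<gamma> \<and>
     (\<forall>c\<in>A. (\<forall>t\<in>{a..b}. \<gamma> t \<in> dom_chart c \<longrightarrow>
                  (coord c \<circ> \<gamma>) differentiable (at t within {a..b})) \<and>
             continuous_on {t\<in>{a..b}. \<gamma> t \<in> dom_chart c} (\<lambda>t. velocity \<gamma> {a..b} t c))"

end


section \<open>Spacetimes\<close>

text \<open>Symmetric bilinear forms of signature \<open>(-+\<dots>+)\<close>: the images under \<open>f\<close> of the standard basis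
  vectors form an orthonormal basis with exactly one negative vector, the image of \<open>e\<^sub>0\<close>.\<close>

definition lorentzian_form :: "('e::euclidean_space \<Rightarrow> 'e \<Rightarrow> real) \<Rightarrow> bool" where
  "lorentzian_form b \<longleftrightarrow> bilinear b \<and> (\<forall>u v. b u v = b v u) \<and>
     (\<exists>f::'e \<Rightarrow> 'e. linear f \<and> bij f \<and>
       (\<exists>e\<^sub>0\<in>Basis. \<forall>i\<in>Basis. \<forall>j\<in>Basis.
          b (f i) (f j) = (if i \<noteq> j then 0 else if i = e\<^sub>0 then - 1 else 1)))"

text \<open>The time orientation is the one determined by a continuous timelike vector field \<open>T\<close>. The values
  of \<open>g p\<close> matter only on tangent vectors at \<open>p\<close>.\<close>

locale smooth_spacetime = smooth_manifold X A
  for X :: "'a topology" and A :: "('a, 'e::euclidean_space) chart set" +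
  fixes g :: "'a \<Rightarrow> (('a, 'e) chart \<Rightarrow> 'e) \<Rightarrow> (('a, 'e) chart \<Rightarrow> 'e) \<Rightarrow> real"
    and T :: "'a \<Rightarrow> (('a, 'e) chart \<Rightarrow> 'e)"
  assumes connected: "connected_space X"
    and dimension: "DIM('e) \<ge> 2"
    and metric_lorentzian: "\<And>c p. c \<in> A \<Longrightarrow> p \<in> dom_chart c \<Longrightarrow>
      lorentzian_form (\<lambda>u v. g p (chart_vector c p u) (chart_vector c p v))"
    and metric_smooth: "\<And>c u v. c \<in> A \<Longrightarrow>
      smooth_on (\<lambda>x. g (chart_inv c x) (chart_vector c (chart_inv c x) u)
                                       (chart_vector c (chart_inv c x) v))
                (coord c ` dom_chart c)"
    and orientation_tangent: "\<And>p. p \<in> topspace X \<Longrightarrow> T p \<in> tangent_space p"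
    and orientation_timelike: "\<And>p. p \<in> topspace X \<Longrightarrow> g p (T p) (T p) < 0"
    and orientation_continuous: "\<And>c. c \<in> A \<Longrightarrow>
      continuous_map (subtopology X (dom_chart c)) euclidean (\<lambda>p. T p c)"
begin

definition causal_vector :: "'a \<Rightarrow> (('a, 'e) chart \<Rightarrow> 'e) \<Rightarrow> bool" where
  "causal_vector p v \<longleftrightarrow> v \<in> tangent_space p \<and> v \<noteq> (\<lambda>_. 0) \<and> g p v v \<le> 0"

definition future_directed :: "'a \<Rightarrow> (('a, 'e) chart \<Rightarrow> 'e) \<Rightarrow> bool" where
  "future_directed p v \<longleftrightarrow> g p v (T p) < 0"

text \<open>Piecewise \<open>C\<^sup>1\<close> curves on \<open>[a, b]\<close>. At the break points \<open>\<tau> i\<close> both one-sided velocities have to be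
  causal and future directed.\<close>

definition causal_curve :: "(real \<Rightarrow> 'a) \<Rightarrow> real \<Rightarrow> real \<Rightarrow> bool" where
  "causal_curve \<gamma> a b \<longleftrightarrow>
     (\<exists>(n::nat) \<tau>. n > 0 \<and> \<tau> 0 = a \<and> \<tau> n = b \<and>
       (\<forall>i<n. C1_curve \<gamma> (\<tau> i) (\<tau> (Suc i)) \<and>
         (\<forall>t\<in>{\<tau> i..\<tau> (Suc i)}.
            causal_vector (\<gamma> t) (velocity \<gamma> {\<tau> i..\<tau> (Suc i)} t) \<and>
            future_directed (\<gamma> t) (velocity \<gamma> {\<tau> i..\<tau> (Suc i)} t))))"

definition causal_le :: "'a \<Rightarrow> 'a \<Rightarrow> bool" where
  "causal_le x y \<longleftrightarrow> x \<in> topspace X \<and> y \<in> topspace X \<and>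
     (x = y \<or> (\<exists>\<gamma> a b. causal_curve \<gamma> a b \<and> \<gamma> a = x \<and> \<gamma> b = y))"

definition J_plus :: "'a set \<Rightarrow> 'a set" where
  "J_plus S = {y. \<exists>x\<in>S. causal_le x y}"

definition J_minus :: "'a set \<Rightarrow> 'a set" where
  "J_minus S = {y. \<exists>x\<in>S. causal_le y x}"

definition causally_convex :: "'a set \<Rightarrow> bool" where
  "causally_convex U \<longleftrightarrow>
     (\<forall>a\<in>U. \<forall>b\<in>U. \<forall>z. causal_le a z \<and> causal_le z b \<longrightarrow> z \<in> U)"

definition strongly_causal :: bool where
  "strongly_causal \<longleftrightarrow>
     (\<forall>x\<in>topspace X. \<forall>V. openin X V \<and> x \<in> V \<longrightarrow>
       (\<exists>U. openin X U \<and> x \<in> U \<and> U \<subseteq> V \<and> causally_convex U))"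

text \<open>The preorder of the ordered locale of the spacetime, on the frame of open sets of \<open>X\<close>.\<close>

definition Loc_le :: "'a set \<Rightarrow> 'a set \<Rightarrow> bool" where
  "Loc_le U V \<longleftrightarrow> openin X U \<and> openin X V \<and> U \<subseteq> J_minus V \<and> V \<subseteq> J_plus U"

end


section \<open>Order relations on the frame of open sets\<close>

definition up_cone :: "'a topology \<Rightarrow> ('a set \<Rightarrow> 'a set \<Rightarrow> bool) \<Rightarrow> 'a set \<Rightarrow> 'a set" where
  "up_cone X R U = \<Union>{V. openin X V \<and> R U V}"

definition down_cone :: "'a topology \<Rightarrow> ('a set \<Rightarrow> 'a set \<Rightarrow> bool) \<Rightarrow> 'a set \<Rightarrow> 'a set" where
  "down_cone X R U = \<Union>{W. openin X W \<and> R W U}"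

text \<open>The equation expresses that the sets on the right form a base of \<open>X\<close>.\<close>

definition convex_ordered_locale :: "'a topology \<Rightarrow> ('a set \<Rightarrow> 'a set \<Rightarrow> bool) \<Rightarrow> bool" where
  "convex_ordered_locale X R \<longleftrightarrow>
     openin X = arbitrary union_of
       (\<lambda>U. openin X U \<and> U = up_cone X R U \<inter> down_cone X R U)"

end

theory Submission
  imports Defs
begin

text \<open>For open \<open>U\<close> the sets \<open>J\<^sup>+(U)\<close> and \<open>J\<^sup>-(U)\<close> are open: a causal curve can be displaced slightly,
  moving one end point arbitrarily, if the displacement grows fast enough in a timelike direction
  to absorb the variation of the metric. Hence the localic cones of \<open>U\<close> are \<open>J\<^sup>+(U)\<close> and \<open>J\<^sup>-(U)\<close>,
  and the equation \<open>U = J\<^sup>+(U) \<inter> J\<^sup>-(U)\<close> says exactly that \<open>U\<close> is causally convex.\<close>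

section \<open>Smooth functions and bilinear forms\<close>

text \<open>The difficulty lies in null curves. They satisfy \<open>g(v, v) \<le> 0\<close> without
  margin, so a translate in a chart can leave the cones as soon as the metric varies. What does have
  a margin is the product of the velocity with a timelike vector \<open>u\<close> taken from the
  time orientation: it is strictly negative. Adding \<open>l u\<close> to the velocity gains a term
  linear in \<open>l\<close>, against a loss proportional to the displacement. But the correction
  displaces the curve further, so the requirement is a differential inequality of Gronwall type,
  solved by an exponential whose rate is fixed in advance. The whole displacement is then bounded by
  a multiple of its prescribed value at one end, which keeps the other end inside a given open set.
  The constants exist only near one parameter value and in one chart; compactness of the parameter
  interval joins the pieces. Geodesics, normal neighbourhoods and the chronological relation are
  thereby avoided.\<close>

lemma linear_basis_expansion:
  fixes f :: "'e::euclidean_space \<Rightarrow> 'f::real_vector"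
  assumes "linear f"
  shows "f u = (\<Sum>i\<in>Basis. (u \<bullet> i) *\<^sub>R f i)"
proof -
  have "f u = f (\<Sum>i\<in>Basis. (u \<bullet> i) *\<^sub>R i)"
    by (simp add: euclidean_representation)
  also have "\<dots> = (\<Sum>i\<in>Basis. (u \<bullet> i) *\<^sub>R f i)"
    using assms by (simp add: linear_sum linear_cmul)
  finally show ?thesis .
qed

text \<open>Reduces a form that varies with the point to finitely many coefficients, since
  smoothness of the metric is given for fixed arguments only.\<close>

lemma bilinear_basis_expansion:
  fixes b :: "'e::euclidean_space \<Rightarrow> 'e \<Rightarrow> real"
  assumes "bilinear b"
  shows "b u v = (\<Sum>i\<in>Basis. \<Sum>j\<in>Basis. (u \<bullet> i) * (v \<bullet> j) * b i j)"
proof -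
  have l: "linear (\<lambda>x. b x v)" and r: "linear (b i)" for i
    using assms by (auto simp: bilinear_def)
  have "b u v = (\<Sum>i\<in>Basis. (u \<bullet> i) * b i v)"
    using linear_basis_expansion[OF l, of u] by simp
  also have "\<dots> = (\<Sum>i\<in>Basis. (u \<bullet> i) * (\<Sum>j\<in>Basis. (v \<bullet> j) * b i j))"
    using linear_basis_expansion[OF r, of _ v] by simp
  finally show ?thesis
    by (simp add: sum_distrib_left mult.assoc)
qed

lemma smooth_on_imp_continuous_on: "smooth_on f S \<Longrightarrow> continuous_on S f"
  unfolding smooth_on_def by (metis Ck_on.simps(1))

lemma smooth_on_imp_differentiable: "smooth_on f S \<Longrightarrow> x \<in> S \<Longrightarrow> f differentiable (at x)"
  unfolding smooth_on_def by (metis Ck_on.simps(2))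

lemma smooth_on_imp_has_derivative:
  "smooth_on f S \<Longrightarrow> x \<in> S \<Longrightarrow> (f has_derivative frechet_derivative f (at x)) (at x)"
  by (simp add: smooth_on_imp_differentiable flip: frechet_derivative_works)

lemma smooth_on_imp_continuous_derivative:
  assumes "smooth_on f S"
  shows "continuous_on S (\<lambda>x. frechet_derivative f (at x) v)"
proof -
  have "Ck_on (Suc 0) f S"
    using assms by (auto simp only: smooth_on_def)
  then show ?thesis by simp
qed

text \<open>\<open>smooth_on\<close> controls each directional derivative separately. Compactness
  bounds those along the basis, their bounds add up to one for the operator norm, and convexity of
  the ball admits the mean value inequality.\<close>

lemma smooth_on_lipschitz_cball:
  fixes f :: "'e::euclidean_space \<Rightarrow> real"
  assumes f: "smooth_on f S" and sub: "cball x0 R \<subseteq> S"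
  shows "\<exists>L\<ge>0. \<forall>y\<in>cball x0 R. \<forall>z\<in>cball x0 R. \<bar>f y - f z\<bar> \<le> L * norm (y - z)"
proof -
  let ?D = "\<lambda>x. frechet_derivative f (at x)"
  have "\<exists>B. \<forall>x\<in>cball x0 R. \<bar>?D x i\<bar> \<le> B" for i
  proof -
    have "continuous_on (cball x0 R) (\<lambda>x. ?D x i)"
      using smooth_on_imp_continuous_derivative[OF f] sub continuous_on_subset by blast
    then have "compact ((\<lambda>x. ?D x i) ` cball x0 R)"
      by (rule compact_continuous_image) simp
    then have "bounded ((\<lambda>x. ?D x i) ` cball x0 R)"
      by (rule compact_imp_bounded)
    then show ?thesis by (auto simp: bounded_iff)
  qed
  then obtain B where B: "\<And>i x. x \<in> cball x0 R \<Longrightarrow> \<bar>?D x i\<bar> \<le> B i" by metis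
  define L where "L = (\<Sum>i\<in>(Basis::'e set). \<bar>B i\<bar>)"
  have bound: "norm (?D x h) \<le> L * norm h" if "x \<in> cball x0 R" for x h
  proof -
    have lin: "linear (?D x)"
      using smooth_on_imp_differentiable[OF f] that sub by (blast intro: linear_frechet_derivative)
    have "norm (?D x h) = \<bar>\<Sum>i\<in>Basis. (h \<bullet> i) * ?D x i\<bar>"
      using linear_basis_expansion[OF lin, of h] by simp
    also have "\<dots> \<le> (\<Sum>i\<in>Basis. \<bar>(h \<bullet> i) * ?D x i\<bar>)" by (rule sum_abs)
    also have "\<dots> \<le> (\<Sum>i\<in>Basis. norm h * \<bar>B i\<bar>)"
    proof (rule sum_mono)
      fix i :: 'e assume "i \<in> Basis"
      then show "\<bar>(h \<bullet> i) * ?D x i\<bar> \<le> norm h * \<bar>B i\<bar>"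
        unfolding abs_mult using B[OF that, of i]
        by (intro mult_mono) (auto simp: Basis_le_norm)
    qed
    finally show ?thesis by (simp add: L_def sum_distrib_left mult.commute)
  qed
  have "norm (f y - f z) \<le> L * norm (y - z)" if "y \<in> cball x0 R" "z \<in> cball x0 R" for y z
  proof (rule differentiable_bound[where S="cball x0 R" and f'="?D"])
    show "(f has_derivative ?D x) (at x within cball x0 R)" if "x \<in> cball x0 R" for x
      using smooth_on_imp_has_derivative[OF f] that sub has_derivative_at_withinI by blast
    show "onorm (?D x) \<le> L" if "x \<in> cball x0 R" for x
      using bound[OF that] by (intro onorm_le) auto
  qed (use that in auto)
  moreover have "L \<ge> 0" unfolding L_def by (simp add: sum_nonneg)
  ultimately show ?thesis by auto
qed

text \<open>\<open>E\<close> stands for an exponential growth factor. Using \<open>E - 1\<close>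
  makes the displacement equal \<open>w\<close> where \<open>E = 1\<close>; the bound is
  nevertheless a multiple of \<open>E\<close>, hence comparable with the derivative of the
  exponential.\<close>

lemma exp_perturbation_bound:
  fixes w u :: "'e::real_normed_vector"
  assumes "E \<ge> 1"
  shows "norm (w + (norm w * (E - 1)) *\<^sub>R u) \<le> norm w * (1 + norm u) * E"
    and "norm (w - (norm w * (E - 1)) *\<^sub>R u) \<le> norm w * (1 + norm u) * E"
proof -
  have eq: "norm ((norm w * (E - 1)) *\<^sub>R u) = norm w * (E - 1) * norm u"
    using assms by simp
  have "norm w * 1 \<le> norm w * E" using assms by (intro mult_left_mono) auto
  then have "norm w + norm w * (E - 1) * norm u \<le> norm w * (1 + norm u) * E"
    by (simp add: algebra_simps add_increasing2)
  with eq show "norm (w + (norm w * (E - 1)) *\<^sub>R u) \<le> norm w * (1 + norm u) * E"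
    and "norm (w - (norm w * (E - 1)) *\<^sub>R u) \<le> norm w * (1 + norm u) * E"
    using norm_triangle_ineq[of w "(norm w * (E - 1)) *\<^sub>R u"]
      norm_triangle_ineq4[of w "(norm w * (E - 1)) *\<^sub>R u"] by linarith+
qed

section \<open>Charts and curves\<close>

context smooth_manifold
begin

section \<open>Topology of charts\<close>

lemma dom_chart_subset: "c \<in> A \<Longrightarrow> dom_chart c \<subseteq> topspace X"
  using chart_cover by blast

lemma topspace_dom_chart: "c \<in> A \<Longrightarrow> topspace (subtopology X (dom_chart c)) = dom_chart c"
  by (simp add: dom_chart_subset Int_absorb1)

lemma inj_on_coord: "c \<in> A \<Longrightarrow> inj_on (coord c) (dom_chart c)"
  using homeomorphic_imp_injective_map[OF chart_homeo] topspace_dom_chart by metis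

lemma chart_inv_coord [simp]: "c \<in> A \<Longrightarrow> p \<in> dom_chart c \<Longrightarrow> chart_inv c (coord c p) = p"
  unfolding chart_inv_def using inj_on_coord by (simp add: inv_into_f_f)

lemma coord_chart_inv [simp]: "y \<in> coord c ` dom_chart c \<Longrightarrow> coord c (chart_inv c y) = y"
  unfolding chart_inv_def by (rule f_inv_into_f)

lemma chart_inv_in_dom [simp]: "y \<in> coord c ` dom_chart c \<Longrightarrow> chart_inv c y \<in> dom_chart c"
  unfolding chart_inv_def by (rule inv_into_into)

lemma open_coord_image:
  assumes "c \<in> A" "openin X W" "W \<subseteq> dom_chart c"
  shows "open (coord c ` W)"
proof -
  have "openin (subtopology X (dom_chart c)) W"
    using assms by (simp add: openin_subset_topspace_eq openin_open_subtopology chart_open)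
  then have "openin (top_of_set (coord c ` dom_chart c)) (coord c ` W)"
    using homeomorphic_imp_open_map[OF chart_homeo[OF assms(1)]] by (simp add: open_map_def)
  then show ?thesis
    using chart_image_open[OF assms(1)] openin_open_eq by blast
qed

lemma openin_coord_vimage:
  assumes "c \<in> A" "open S"
  shows "openin X {p \<in> dom_chart c. coord c p \<in> S}"
proof -
  have "continuous_map (subtopology X (dom_chart c)) (top_of_set (coord c ` dom_chart c)) (coord c)"
    using homeomorphic_imp_continuous_map[OF chart_homeo[OF assms(1)]] .
  then have "continuous_map (subtopology X (dom_chart c)) euclidean (coord c)"
    using continuous_map_into_fulltopology by blast
  then have "openin (subtopology X (dom_chart c)) {p \<in> dom_chart c. coord c p \<in> S}"
    using openin_continuous_map_preimage[of "subtopology X (dom_chart c)" euclidean "coord c" S]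
      assms(2) unfolding topspace_dom_chart[OF assms(1)] by simp
  then show ?thesis
    using chart_open[OF assms(1)] openin_open_subtopology by blast
qed

lemma continuous_map_chart_inv:
  assumes "c \<in> A"
  shows "continuous_map (top_of_set (coord c ` dom_chart c)) (subtopology X (dom_chart c)) (chart_inv c)"
  unfolding continuous_map
proof (intro conjI allI impI)
  show "chart_inv c ` topspace (top_of_set (coord c ` dom_chart c))
      \<subseteq> topspace (subtopology X (dom_chart c))"
    unfolding topspace_dom_chart[OF assms] topspace_euclidean_subtopology
    by (intro image_subsetI chart_inv_in_dom)
  fix W assume W: "openin (subtopology X (dom_chart c)) W"
  then have sub: "W \<subseteq> dom_chart c" "openin X W"
    using openin_open_subtopology[OF chart_open[OF assms]] by simp_all
  have "{y \<in> coord c ` dom_chart c. chart_inv c y \<in> W} = coord c ` W"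
  proof (intro set_eqI iffI)
    fix y assume "y \<in> {y \<in> coord c ` dom_chart c. chart_inv c y \<in> W}"
    then show "y \<in> coord c ` W"
      by (metis (no_types, lifting) coord_chart_inv imageI mem_Collect_eq)
  next
    fix y assume "y \<in> coord c ` W"
    then obtain p where "p \<in> W" "y = coord c p" by blast
    then show "y \<in> {y \<in> coord c ` dom_chart c. chart_inv c y \<in> W}"
      using sub(1) chart_inv_coord[OF assms, of p] by (simp add: subset_iff)
  qed
  then show "openin (top_of_set (coord c ` dom_chart c))
      {y \<in> topspace (top_of_set (coord c ` dom_chart c)). chart_inv c y \<in> W}"
    using open_coord_image[OF assms sub(2,1)] image_mono[OF sub(1), of "coord c"]
    by (simp add: open_subset)
qed

lemma continuous_map_chart_inv':
  "c \<in> A \<Longrightarrow> continuous_map (top_of_set (coord c ` dom_chart c)) X (chart_inv c)"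
  using continuous_map_chart_inv continuous_map_into_fulltopology by blast

section \<open>Transition maps and tangent vectors\<close>

lemma transition_coord [simp]:
  "c \<in> A \<Longrightarrow> p \<in> dom_chart c \<Longrightarrow> transition c d (coord c p) = coord d p"
  by (simp add: transition_def)

lemma open_overlap:
  "c \<in> A \<Longrightarrow> d \<in> A \<Longrightarrow> open (coord c ` (dom_chart c \<inter> dom_chart d))"
  by (intro open_coord_image) (auto intro: chart_open)

lemma transition_has_derivative:
  assumes "c \<in> A" "d \<in> A" "p \<in> dom_chart c" "p \<in> dom_chart d"
  shows "(transition c d has_derivative frechet_derivative (transition c d) (at (coord c p)))
    (at (coord c p))"
  using smooth_on_imp_has_derivative[OF chart_compatible[OF assms(1,2)]] assms by blast

text \<open>The chain rule for \<open>transition c e\<close> factored through \<open>d\<close>. The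
  factorization is used only over the overlap of \<open>c\<close> and \<open>d\<close>, an open set,
  which suffices for derivatives.\<close>

lemma transition_derivative_cocycle:
  assumes "c \<in> A" "d \<in> A" "e \<in> A"
    and p: "p \<in> dom_chart c" "p \<in> dom_chart d" "p \<in> dom_chart e"
  shows "frechet_derivative (transition c e) (at (coord c p)) u =
    frechet_derivative (transition d e) (at (coord d p))
      (frechet_derivative (transition c d) (at (coord c p)) u)"
proof -
  let ?W = "coord c ` (dom_chart c \<inter> dom_chart d)"
  have "(transition d e \<circ> transition c d has_derivative
      frechet_derivative (transition d e) (at (coord d p)) \<circ>
      frechet_derivative (transition c d) (at (coord c p))) (at (coord c p))"
    using transition_has_derivative[of c d p] transition_has_derivative[of d e p] assms
    by (intro diff_chain_at) auto
  then have "(transition c e has_derivative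
      frechet_derivative (transition d e) (at (coord d p)) \<circ>
      frechet_derivative (transition c d) (at (coord c p))) (at (coord c p))"
  proof (rule has_derivative_transform_within_open[where s="?W"])
    show "open ?W" using assms open_overlap by blast
    show "coord c p \<in> ?W" using p by blast
    show "(transition d e \<circ> transition c d) y = transition c e y" if "y \<in> ?W" for y
      using that assms by auto
  qed
  then show ?thesis
    using frechet_derivative_at by (metis comp_apply)
qed

lemma chart_vector_tangent:
  assumes "c \<in> A" "p \<in> dom_chart c"
  shows "chart_vector c p u \<in> tangent_space p"
  unfolding tangent_space_def mem_Collect_eq
proof (intro conjI ballI impI allI)
  fix d e assume "d \<in> A" "e \<in> A" "p \<in> dom_chart d \<inter> dom_chart e"
  then show "chart_vector c p u e =
      frechet_derivative (transition d e) (at (coord d p)) (chart_vector c p u d)"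
    using transition_derivative_cocycle[OF assms(1), of d e p u] assms(2)
    by (simp add: chart_vector_def)
qed (auto simp: chart_vector_def)

text \<open>One component determines a tangent vector; this is what allows the metric to be
  evaluated in a single chart.\<close>

lemma tangent_eq_chart_vector:
  assumes "v \<in> tangent_space p" "c \<in> A" "p \<in> dom_chart c"
  shows "v = chart_vector c p (v c)"
proof
  fix d
  show "v d = chart_vector c p (v c) d"
  proof (cases "d \<in> A \<and> p \<in> dom_chart d")
    case True
    then have "v d = frechet_derivative (transition c d) (at (coord c p)) (v c)"
      using assms unfolding tangent_space_def by blast
    with True show ?thesis by (simp only: chart_vector_def simp_thms if_True)
  next
    case False
    then have "v d = 0" using assms(1) unfolding tangent_space_def by blast
    with False show ?thesis by (simp only: chart_vector_def if_False)
  qed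
qed

text \<open>Allows curves to be built in the coordinates of one chart: \<open>C1_curve\<close> tests
  every chart of the atlas, and the chain rule with the transition maps transfers regularity from
  \<open>c\<close> to all of them.\<close>

lemma
  fixes z z' :: "real \<Rightarrow> 'e"
  assumes c: "c \<in> A" and "s < t"
    and zO: "\<And>r. r \<in> {s..t} \<Longrightarrow> z r \<in> coord c ` dom_chart c"
    and der: "\<And>r. r \<in> {s..t} \<Longrightarrow> (z has_vector_derivative z' r) (at r within {s..t})"
    and cont: "continuous_on {s..t} z'"
  shows velocity_chart_inv: "\<And>r. r \<in> {s..t} \<Longrightarrow>
      velocity (chart_inv c \<circ> z) {s..t} r = chart_vector c (chart_inv c (z r)) (z' r)"
    and C1_curve_chart_inv: "C1_curve (chart_inv c \<circ> z) s t"
proof -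
  let ?D = "\<lambda>d r. frechet_derivative (transition c d) (at (z r))"
  have contz: "continuous_on {s..t} z"
    using der has_vector_derivative_continuous continuous_on_eq_continuous_within by blast
  have vd: "(coord d \<circ> (chart_inv c \<circ> z) has_vector_derivative ?D d r (z' r)) (at r within {s..t})"
    if "d \<in> A" "r \<in> {s..t}" "chart_inv c (z r) \<in> dom_chart d" for d r
  proof -
    have "(transition c d has_derivative ?D d r) (at (z r))"
      using transition_has_derivative[OF c that(1) _ that(3)] zO[OF that(2)] by simp
    then have "(transition c d has_derivative ?D d r) (at (z r) within z ` {s..t})"
      by (rule has_derivative_at_withinI)
    from vector_derivative_diff_chain_within[OF der[OF that(2)] this]
    show ?thesis by (simp add: transition_def o_def)
  qed
  show vel: "velocity (chart_inv c \<circ> z) {s..t} r = chart_vector c (chart_inv c (z r)) (z' r)"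
    if "r \<in> {s..t}" for r
  proof (rule ext)
    fix d
    show "velocity (chart_inv c \<circ> z) {s..t} r d = chart_vector c (chart_inv c (z r)) (z' r) d"
    proof (cases "d \<in> A \<and> chart_inv c (z r) \<in> dom_chart d")
      case True
      then show ?thesis
        using vector_derivative_within_closed_interval[OF \<open>s < t\<close> that vd[of d r]] that zO[OF that]
        by (simp add: velocity_def chart_vector_def)
    next
      case False
      then show ?thesis by (auto simp: velocity_def chart_vector_def)
    qed
  qed
  show "C1_curve (chart_inv c \<circ> z) s t"
    unfolding C1_curve_def
  proof (intro conjI ballI impI)
    have "continuous_map (top_of_set {s..t}) (top_of_set (coord c ` dom_chart c)) z"
      using contz zO by auto
    then show "continuous_map (top_of_set {s..t}) X (chart_inv c \<circ> z)"
      using continuous_map_chart_inv'[OF c] continuous_map_compose by blast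
  next
    fix d r assume "d \<in> A" "r \<in> {s..t}" "(chart_inv c \<circ> z) r \<in> dom_chart d"
    then show "coord d \<circ> (chart_inv c \<circ> z) differentiable at r within {s..t}"
      using vd[of d r] differentiableI_vector by auto
  next
    fix d assume d: "d \<in> A"
    let ?S = "{r \<in> {s..t}. (chart_inv c \<circ> z) r \<in> dom_chart d}"
    have zS: "z ` ?S \<subseteq> coord c ` (dom_chart c \<inter> dom_chart d)"
    proof safe
      fix r assume r: "r \<in> {s..t}" "(chart_inv c \<circ> z) r \<in> dom_chart d"
      show "z r \<in> coord c ` (dom_chart c \<inter> dom_chart d)"
        by (rule image_eqI[of _ _ "chart_inv c (z r)"]) (use r zO[OF r(1)] in auto)
    qed
    \<comment> \<open>The derivative of a transition map is known to be continuous for fixed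
      directions only, while \<open>z' r\<close> varies with \<open>r\<close>; expansion in the
      basis separates the two dependences.\<close>
    have "continuous_on ?S (\<lambda>r. \<Sum>i\<in>Basis. (z' r \<bullet> i) *\<^sub>R ?D d r i)"
    proof (intro continuous_intros)
      show "continuous_on ?S z'" using cont by (rule continuous_on_subset) auto
      show "continuous_on ?S (\<lambda>r. ?D d r i)" for i
        by (rule continuous_on_compose2[OF smooth_on_imp_continuous_derivative
              [OF chart_compatible[OF c d]] continuous_on_subset[OF contz] zS]) auto
    qed
    moreover have "velocity (chart_inv c \<circ> z) {s..t} r d = (\<Sum>i\<in>Basis. (z' r \<bullet> i) *\<^sub>R ?D d r i)"
      if r: "r \<in> ?S" for r
    proof -
      have "linear (?D d r)"
        using smooth_on_imp_differentiable[OF chart_compatible[OF c d]] zS r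
        by (blast intro: linear_frechet_derivative)
      then show ?thesis
        using vel[of r] r d zO[of r] linear_basis_expansion[of "?D d r" "z' r"]
        by (simp add: chart_vector_def)
    qed
    ultimately show "continuous_on ?S (\<lambda>r. velocity (chart_inv c \<circ> z) {s..t} r d)"
      by (metis (no_types, lifting) continuous_on_cong)
  qed (fact \<open>s < t\<close>)
qed

section \<open>Parameter shifts and locality of curves\<close>

lemma velocity_shift:
  "velocity (\<lambda>r. \<gamma> (r - k)) {a + k..b + k} t = velocity \<gamma> {a..b} (t - k)"
proof
  fix c :: "('a, 'e) chart"
  let ?f = "coord c \<circ> \<gamma>"
  \<comment> \<open>An equivalence for every \<open>v\<close>, because
    \<open>vector_derivative\<close> is a choice from this predicate: the two values then agree even
    where no derivative exists.\<close>
  have "((\<lambda>r. ?f (r - k)) has_vector_derivative v) (at t within {a + k..b + k}) \<longleftrightarrow>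
      (?f has_vector_derivative v) (at (t - k) within {a..b})" for v
  proof
    have img: "(\<lambda>r. r - k) ` {a + k..b + k} = {a..b}" "(\<lambda>r. r + k) ` {a..b} = {a + k..b + k}"
      by (auto simp: image_iff algebra_simps intro: bexI[of _ "_ + k"] bexI[of _ "_ - k"])
    assume "((\<lambda>r. ?f (r - k)) has_vector_derivative v) (at t within {a + k..b + k})"
    then have "((\<lambda>r. ?f (r - k)) has_vector_derivative v)
        (at (t - k + k) within (\<lambda>r. r + k) ` {a..b})" by (simp add: img)
    moreover have "((\<lambda>r. r + k) has_vector_derivative 1) (at (t - k) within {a..b})"
      by (auto intro!: derivative_eq_intros)
    ultimately show "(?f has_vector_derivative v) (at (t - k) within {a..b})"
      using vector_diff_chain_within[of "\<lambda>r. r + k" 1 "t - k" "{a..b}" "\<lambda>r. ?f (r - k)" v]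
      by (simp add: o_def)
  next
    have img: "(\<lambda>r. r - k) ` {a + k..b + k} = {a..b}"
      by (auto simp: image_iff algebra_simps intro: bexI[of _ "_ + k"])
    assume "(?f has_vector_derivative v) (at (t - k) within {a..b})"
    then have "(?f has_vector_derivative v) (at (t - k) within (\<lambda>r. r - k) ` {a + k..b + k})"
      by (simp add: img)
    moreover have "((\<lambda>r. r - k) has_vector_derivative 1) (at t within {a + k..b + k})"
      by (auto intro!: derivative_eq_intros)
    ultimately show "((\<lambda>r. ?f (r - k)) has_vector_derivative v) (at t within {a + k..b + k})"
      using vector_diff_chain_within[of "\<lambda>r. r - k" 1 t "{a + k..b + k}" ?f v]
      by (simp add: o_def)
  qed
  then show "velocity (\<lambda>r. \<gamma> (r - k)) {a + k..b + k} t c = velocity \<gamma> {a..b} (t - k) c"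
    by (simp add: velocity_def vector_derivative_def o_def)
qed

lemma C1_curve_shift:
  assumes "C1_curve \<gamma> a b"
  shows "C1_curve (\<lambda>r. \<gamma> (r - k)) (a + k) (b + k)"
  unfolding C1_curve_def
proof (intro conjI ballI impI)
  show "a + k < b + k" using assms by (simp add: C1_curve_def)
  have sh: "continuous_on {a + k..b + k} (\<lambda>r. r - k)" "(\<lambda>r. r - k) ` {a + k..b + k} \<subseteq> {a..b}"
    by (auto intro!: continuous_intros)
  then have "continuous_map (top_of_set {a + k..b + k}) (top_of_set {a..b}) (\<lambda>r. r - k)" by auto
  from continuous_map_compose[OF this, of X \<gamma>] assms
  show "continuous_map (top_of_set {a + k..b + k}) X (\<lambda>r. \<gamma> (r - k))"
    by (simp add: C1_curve_def o_def)
  fix c assume c: "c \<in> A"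
  show "coord c \<circ> (\<lambda>r. \<gamma> (r - k)) differentiable at t within {a + k..b + k}"
    if t: "t \<in> {a + k..b + k}" "\<gamma> (t - k) \<in> dom_chart c" for t
  proof -
    have "coord c \<circ> \<gamma> differentiable at (t - k) within {a..b}"
      using assms t c by (auto simp: C1_curve_def)
    then have "coord c \<circ> \<gamma> differentiable at (t - k) within (\<lambda>r. r - k) ` {a + k..b + k}"
      using sh(2) differentiable_within_subset by blast
    moreover have "(\<lambda>r. r - k) differentiable at t within {a + k..b + k}" by simp
    ultimately have "(coord c \<circ> \<gamma>) \<circ> (\<lambda>r. r - k) differentiable at t within {a + k..b + k}"
      using differentiable_chain_within by blast
    then show ?thesis by (simp add: o_def)
  qed
  have "continuous_on {t \<in> {a..b}. \<gamma> t \<in> dom_chart c} (\<lambda>t. velocity \<gamma> {a..b} t c)"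
    using assms c by (simp add: C1_curve_def)
  then show "continuous_on {t \<in> {a + k..b + k}. \<gamma> (t - k) \<in> dom_chart c}
     (\<lambda>t. velocity (\<lambda>r. \<gamma> (r - k)) {a + k..b + k} t c)"
    unfolding velocity_shift
    by (rule continuous_on_compose2) (auto intro!: continuous_intros)
qed

text \<open>Velocities are derivatives within the interval, hence blind to values outside it. The
  pieces of a concatenated curve can therefore be treated separately.\<close>

lemma velocity_cong:
  assumes "\<And>r. r \<in> {a..b} \<Longrightarrow> \<gamma> r = \<delta> r" "t \<in> {a..b}"
  shows "velocity \<gamma> {a..b} t = velocity \<delta> {a..b} t"
proof
  fix c :: "('a, 'e) chart"
  have "((coord c \<circ> \<gamma>) has_vector_derivative v) (at t within {a..b}) \<longleftrightarrow>
      ((coord c \<circ> \<delta>) has_vector_derivative v) (at t within {a..b})" for v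
    using assms has_vector_derivative_transform[of t "{a..b}" "coord c \<circ> \<gamma>" "coord c \<circ> \<delta>" v]
      has_vector_derivative_transform[of t "{a..b}" "coord c \<circ> \<delta>" "coord c \<circ> \<gamma>" v] by auto
  then show "velocity \<gamma> {a..b} t c = velocity \<delta> {a..b} t c"
    using assms by (simp add: velocity_def vector_derivative_def)
qed

lemma C1_curve_cong:
  assumes eq: "\<And>r. r \<in> {a..b} \<Longrightarrow> \<gamma> r = \<delta> r" and C: "C1_curve \<gamma> a b"
  shows "C1_curve \<delta> a b"
  unfolding C1_curve_def
proof (intro conjI ballI impI)
  show "a < b" using C by (simp add: C1_curve_def)
  show "continuous_map (top_of_set {a..b}) X \<delta>"
    using C eq by (auto simp: C1_curve_def intro: continuous_map_eq)
  fix c assume c: "c \<in> A"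
  show "coord c \<circ> \<delta> differentiable at t within {a..b}"
    if t: "t \<in> {a..b}" "\<delta> t \<in> dom_chart c" for t
  proof -
    have "coord c \<circ> \<gamma> differentiable at t within {a..b}"
      using C t c eq[of t] by (auto simp: C1_curve_def)
    then show ?thesis
      by (rule differentiable_transform_within[where d=1]) (use t eq in auto)
  qed
  have "{t \<in> {a..b}. \<gamma> t \<in> dom_chart c} = {t \<in> {a..b}. \<delta> t \<in> dom_chart c}"
    using eq by auto
  moreover have "continuous_on {t \<in> {a..b}. \<gamma> t \<in> dom_chart c} (\<lambda>t. velocity \<gamma> {a..b} t c)"
    using C c by (simp add: C1_curve_def)
  ultimately have "continuous_on {t \<in> {a..b}. \<delta> t \<in> dom_chart c} (\<lambda>t. velocity \<gamma> {a..b} t c)"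
    by simp
  then show "continuous_on {t \<in> {a..b}. \<delta> t \<in> dom_chart c} (\<lambda>t. velocity \<delta> {a..b} t c)"
  proof (rule continuous_on_eq)
    show "velocity \<gamma> {a..b} t c = velocity \<delta> {a..b} t c"
      if "t \<in> {t \<in> {a..b}. \<delta> t \<in> dom_chart c}" for t
      using velocity_cong[of a b \<gamma> \<delta> t] eq that by simp
  qed
qed

end

section \<open>Spacetimes\<close>

context smooth_spacetime
begin

section \<open>The metric in coordinates\<close>

definition metric_in_chart :: "('a, 'e) chart \<Rightarrow> 'e \<Rightarrow> 'e \<Rightarrow> 'e \<Rightarrow> real" where
  "metric_in_chart c y u v =
     g (chart_inv c y) (chart_vector c (chart_inv c y) u) (chart_vector c (chart_inv c y) v)"

lemma metric_eq_metric_in_chart: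
  assumes "c \<in> A" "p \<in> dom_chart c" "v \<in> tangent_space p" "w \<in> tangent_space p"
  shows "g p v w = metric_in_chart c (coord c p) (v c) (w c)"
  unfolding metric_in_chart_def chart_inv_coord[OF assms(1,2)]
  using tangent_eq_chart_vector[OF assms(3,1,2)] tangent_eq_chart_vector[OF assms(4,1,2)]
  by (metis (no_types))

lemma
  assumes "c \<in> A" "y \<in> coord c ` dom_chart c"
  shows bilinear_metric_in_chart: "bilinear (metric_in_chart c y)"
    and metric_in_chart_commute: "metric_in_chart c y u v = metric_in_chart c y v u"
  using metric_lorentzian[OF assms(1) chart_inv_in_dom[OF assms(2)]]
  unfolding lorentzian_form_def metric_in_chart_def by blast+

lemma metric_in_chart_expansion:
  assumes "c \<in> A" "y \<in> coord c ` dom_chart c"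
  shows "metric_in_chart c y u v =
    (\<Sum>i\<in>Basis. \<Sum>j\<in>Basis. (u \<bullet> i) * (v \<bullet> j) * metric_in_chart c y i j)"
  using bilinear_basis_expansion[OF bilinear_metric_in_chart[OF assms]] .

lemma smooth_on_metric_in_chart:
  "c \<in> A \<Longrightarrow> smooth_on (\<lambda>y. metric_in_chart c y u v) (coord c ` dom_chart c)"
  unfolding metric_in_chart_def by (rule metric_smooth)

text \<open>Point and arguments vary together here, whereas smoothness of the metric concerns the
  point alone; the basis expansion bridges the gap.\<close>

lemma continuous_on_metric_in_chart:
  assumes c: "c \<in> A"
    and f: "continuous_on S f" "f ` S \<subseteq> coord c ` dom_chart c"
    and u: "continuous_on S u" and v: "continuous_on S v"
  shows "continuous_on S (\<lambda>s. metric_in_chart c (f s) (u s) (v s))"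
proof -
  have "continuous_on S (\<lambda>s. \<Sum>i\<in>Basis. \<Sum>j\<in>Basis.
      (u s \<bullet> i) * (v s \<bullet> j) * metric_in_chart c (f s) i j)"
    by (intro continuous_intros u v continuous_on_compose2[OF smooth_on_imp_continuous_on
          [OF smooth_on_metric_in_chart[OF c]] f])
  then show ?thesis
  proof (rule continuous_on_eq)
    fix s assume "s \<in> S"
    then have "f s \<in> coord c ` dom_chart c" using f(2) by blast
    from metric_in_chart_expansion[OF c this, of "u s" "v s"]
    show "(\<Sum>i\<in>Basis. \<Sum>j\<in>Basis. (u s \<bullet> i) * (v s \<bullet> j) * metric_in_chart c (f s) i j) =
        metric_in_chart c (f s) (u s) (v s)" ..
  qed
qed

lemma metric_in_chart_lipschitz:
  assumes c: "c \<in> A" and sub: "cball x0 R \<subseteq> coord c ` dom_chart c"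
  obtains L where "L \<ge> 0"
    "\<And>y z v. y \<in> cball x0 R \<Longrightarrow> z \<in> cball x0 R \<Longrightarrow>
      \<bar>metric_in_chart c y v v - metric_in_chart c z v v\<bar> \<le> L * norm (y - z) * (norm v)\<^sup>2"
proof -
  let ?M = "metric_in_chart c"
  have "\<exists>L\<ge>0. \<forall>y\<in>cball x0 R. \<forall>z\<in>cball x0 R. \<bar>?M y i j - ?M z i j\<bar> \<le> L * norm (y - z)" for i j
    by (rule smooth_on_lipschitz_cball[OF smooth_on_metric_in_chart[OF c] sub])
  then obtain B where B0: "\<And>i j. B i j \<ge> 0"
    and B: "\<And>i j y z. y \<in> cball x0 R \<Longrightarrow> z \<in> cball x0 R \<Longrightarrow>
      \<bar>?M y i j - ?M z i j\<bar> \<le> B i j * norm (y - z)"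
    by metis
  define L where "L = (\<Sum>i\<in>(Basis::'e set). \<Sum>j\<in>(Basis::'e set). B i j)"
  show thesis
  proof
    show "L \<ge> 0" unfolding L_def by (intro sum_nonneg B0)
    fix y z v assume yz: "y \<in> cball x0 R" "z \<in> cball x0 R"
    have eq: "?M y v v - ?M z v v =
        (\<Sum>i\<in>Basis. \<Sum>j\<in>Basis. (v \<bullet> i) * (v \<bullet> j) * (?M y i j - ?M z i j))"
      using metric_in_chart_expansion[OF c, of y v v] metric_in_chart_expansion[OF c, of z v v] yz sub
      by (simp add: subset_iff sum_subtractf right_diff_distrib)
    have "\<bar>?M y v v - ?M z v v\<bar> \<le> (\<Sum>i\<in>Basis. \<Sum>j\<in>Basis. \<bar>(v \<bullet> i) * (v \<bullet> j) * (?M y i j - ?M z i j)\<bar>)"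
      unfolding eq by (rule order.trans[OF sum_abs sum_mono[OF sum_abs]])
    also have "\<dots> \<le> (\<Sum>i\<in>Basis. \<Sum>j\<in>Basis. (norm v * norm v) * (B i j * norm (y - z)))"
      unfolding abs_mult
      by (intro sum_mono mult_mono B[OF yz]) (auto simp: Basis_le_norm)
    also have "\<dots> = L * norm (y - z) * (norm v)\<^sup>2"
      unfolding L_def
      by (simp add: power2_eq_square sum_distrib_left sum_distrib_right mult_ac)
    finally show "\<bar>?M y v v - ?M z v v\<bar> \<le> L * norm (y - z) * (norm v)\<^sup>2" .
  qed
qed

lemma continuous_on_orientation_in_chart:
  assumes "c \<in> A"
  shows "continuous_on (coord c ` dom_chart c) (\<lambda>y. T (chart_inv c y) c)"
  using continuous_map_compose[OF continuous_map_chart_inv[OF assms] orientation_continuous[OF assms]]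
  by (simp add: o_def)

subsection \<open>The causal relation\<close>

text \<open>The piece between consecutive break points of a causal curve. Piecewise curves become
  chains of such pieces, so the analysis never meets a break point.\<close>

definition causal_segment :: "(real \<Rightarrow> 'a) \<Rightarrow> real \<Rightarrow> real \<Rightarrow> bool" where
  "causal_segment \<gamma> a b \<longleftrightarrow> C1_curve \<gamma> a b \<and>
     (\<forall>t\<in>{a..b}. causal_vector (\<gamma> t) (velocity \<gamma> {a..b} t) \<and>
       future_directed (\<gamma> t) (velocity \<gamma> {a..b} t))"

lemma causal_curve_iff_segments:
  "causal_curve \<gamma> a b \<longleftrightarrow> (\<exists>(n::nat) \<tau>. n > 0 \<and> \<tau> 0 = a \<and> \<tau> n = b \<and>
     (\<forall>i<n. causal_segment \<gamma> (\<tau> i) (\<tau> (Suc i))))"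
  unfolding causal_curve_def causal_segment_def ..

lemma causal_segment_less: "causal_segment \<gamma> a b \<Longrightarrow> a < b"
  by (simp add: causal_segment_def C1_curve_def)

lemma causal_segment_in_topspace:
  assumes "causal_segment \<gamma> a b" "t \<in> {a..b}"
  shows "\<gamma> t \<in> topspace X"
proof -
  have "continuous_map (top_of_set {a..b}) X \<gamma>"
    using assms(1) by (simp add: causal_segment_def C1_curve_def)
  then show ?thesis
    using assms(2) by (auto simp: continuous_map_def)
qed

lemma causal_segment_shift:
  assumes "causal_segment \<gamma> a b"
  shows "causal_segment (\<lambda>r. \<gamma> (r - k)) (a + k) (b + k)"
  using assms C1_curve_shift[of \<gamma> a b k]
  unfolding causal_segment_def velocity_shift by simp

lemma causal_segment_cong:
  assumes eq: "\<And>r. r \<in> {a..b} \<Longrightarrow> \<gamma> r = \<delta> r" and "causal_segment \<gamma> a b"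
  shows "causal_segment \<delta> a b"
  unfolding causal_segment_def
proof (intro conjI[OF _ ballI])
  show "C1_curve \<delta> a b"
    using assms(2) by (intro C1_curve_cong[OF eq]) (auto simp: causal_segment_def)
  fix t assume t: "t \<in> {a..b}"
  show "causal_vector (\<delta> t) (velocity \<delta> {a..b} t) \<and> future_directed (\<delta> t) (velocity \<delta> {a..b} t)"
    using assms(2) t velocity_cong[of a b \<gamma> \<delta> t] eq unfolding causal_segment_def by force
qed

definition causal_step :: "'a \<Rightarrow> 'a \<Rightarrow> bool" where
  "causal_step p q \<longleftrightarrow> (\<exists>\<gamma> a b. causal_segment \<gamma> a b \<and> \<gamma> a = p \<and> \<gamma> b = q)"

lemma causal_step_in_topspace: "causal_step p q \<Longrightarrow> p \<in> topspace X \<and> q \<in> topspace X"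
  using causal_segment_in_topspace causal_segment_less unfolding causal_step_def by fastforce

text \<open>The parameter of \<open>\<delta>\<close> is shifted by \<open>b - c\<close> to continue
  that of \<open>\<gamma>\<close>. The junction becomes a new break point, so the two velocities
  there may differ.\<close>

lemma causal_curve_append:
  assumes \<gamma>: "causal_curve \<gamma> a b" and \<delta>: "causal_segment \<delta> c d" and join: "\<gamma> b = \<delta> c"
  shows "\<exists>\<eta> e. causal_curve \<eta> a e \<and> \<eta> a = \<gamma> a \<and> \<eta> e = \<delta> d"
proof -
  obtain n :: nat and \<tau> where n: "n > 0" "\<tau> 0 = a" "\<tau> n = b"
    and seg: "\<And>i. i < n \<Longrightarrow> causal_segment \<gamma> (\<tau> i) (\<tau> (Suc i))"
    using \<gamma> unfolding causal_curve_iff_segments by blast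
  \<comment> \<open>Ensures that the old pieces lie in the branch \<open>t \<le> b\<close> of the
    glued curve.\<close>
  have le: "\<tau> i \<le> b" if "i \<le> n" for i
    using that
  proof (induction rule: inc_induct)
    case (step i)
    then show ?case using causal_segment_less[OF seg[of i]] by linarith
  qed (simp add: n)
  define \<eta> where "\<eta> = (\<lambda>t. if t \<le> b then \<gamma> t else \<delta> (t - (b - c)))"
  define e where "e = d + (b - c)"
  have cd: "c < d" using causal_segment_less[OF \<delta>] .
  define \<rho> where "\<rho> = \<tau>(Suc n := e)"
  have "causal_segment \<eta> (\<rho> i) (\<rho> (Suc i))" if "i < Suc n" for i
  proof (cases "i = n")
    case True
    have "causal_segment (\<lambda>r. \<delta> (r - (b - c))) b e"
      using causal_segment_shift[OF \<delta>, of "b - c"] by (simp add: e_def)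
    then have "causal_segment \<eta> b e"
      by (rule causal_segment_cong[rotated]) (auto simp: \<eta>_def join)
    then show ?thesis using True n by (simp add: \<rho>_def)
  next
    case False
    then have i: "i < n" "Suc i \<le> n" using that by auto
    have "causal_segment \<eta> (\<tau> i) (\<tau> (Suc i))"
      by (rule causal_segment_cong[OF _ seg[OF i(1)]]) (use le[OF i(2)] in \<open>auto simp: \<eta>_def\<close>)
    then show ?thesis using i by (simp add: \<rho>_def)
  qed
  moreover have "\<rho> 0 = a" "\<rho> (Suc n) = e" using n by (auto simp: \<rho>_def)
  ultimately have "causal_curve \<eta> a e"
    unfolding causal_curve_iff_segments by (intro exI[of _ "Suc n"] exI[of _ \<rho>]) simp
  moreover have "\<eta> a = \<gamma> a" using le[of 0] n by (simp add: \<eta>_def)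
  moreover have "\<eta> e = \<delta> d" using cd by (simp add: \<eta>_def e_def)
  ultimately show ?thesis by blast
qed

lemma causal_segment_imp_causal_curve:
  "causal_segment \<gamma> a b \<Longrightarrow> causal_curve \<gamma> a b"
  unfolding causal_curve_iff_segments
  by (intro exI[of _ 1] exI[of _ "\<lambda>i. if i = 0 then a else b"]) simp

text \<open>Makes transitivity immediate and reduces every reflexive, transitive property of
  causally related points to single segments. The condition on \<open>p\<close> is there because the
  closure is reflexive also outside the manifold.\<close>

lemma causal_le_iff_rtranclp:
  "causal_le p q \<longleftrightarrow> p \<in> topspace X \<and> causal_step\<^sup>*\<^sup>* p q"
proof
  assume pq: "causal_le p q"
  then consider "p = q" | \<gamma> a b where "causal_curve \<gamma> a b" "\<gamma> a = p" "\<gamma> b = q"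
    unfolding causal_le_def by blast
  then have "causal_step\<^sup>*\<^sup>* p q"
  proof cases
    case 2
    obtain n :: nat and \<tau> where n: "\<tau> 0 = a" "\<tau> n = b"
      and seg: "\<And>i. i < n \<Longrightarrow> causal_segment \<gamma> (\<tau> i) (\<tau> (Suc i))"
      using 2(1) unfolding causal_curve_iff_segments by blast
    have "causal_step\<^sup>*\<^sup>* p (\<gamma> (\<tau> i))" if "i \<le> n" for i
      using that
    proof (induction i)
      case (Suc i)
      then have "causal_step (\<gamma> (\<tau> i)) (\<gamma> (\<tau> (Suc i)))"
        using seg[of i] unfolding causal_step_def by auto
      with Suc show ?case by auto
    qed (simp add: n 2)
    from this[of n] show ?thesis by (simp add: n 2)
  qed simp
  then show "p \<in> topspace X \<and> causal_step\<^sup>*\<^sup>* p q"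
    using pq by (simp add: causal_le_def)
next
  assume "p \<in> topspace X \<and> causal_step\<^sup>*\<^sup>* p q"
  then have p: "p \<in> topspace X" and "causal_step\<^sup>*\<^sup>* p q" by auto
  from this(2) show "causal_le p q"
  proof induction
    case base
    then show ?case using p by (simp add: causal_le_def)
  next
    case (step q r)
    obtain \<delta> c d where \<delta>: "causal_segment \<delta> c d" "\<delta> c = q" "\<delta> d = r"
      using step(2) unfolding causal_step_def by blast
    have r: "r \<in> topspace X" using causal_step_in_topspace[OF step(2)] by simp
    \<comment> \<open>Equality supplies no curve to extend, since the parameter interval of a causal
      curve is nondegenerate.\<close>
    show ?case
    proof (cases "p = q")
      case True
      then show ?thesis
        using p r \<delta> causal_segment_imp_causal_curve[OF \<delta>(1)] unfolding causal_le_def by blast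
    next
      case False
      then obtain \<gamma> a b where "causal_curve \<gamma> a b" "\<gamma> a = p" "\<gamma> b = q"
        using step.IH unfolding causal_le_def by blast
      then show ?thesis
        using p r \<delta> causal_curve_append[of \<gamma> a b \<delta> c d] unfolding causal_le_def by metis
    qed
  qed
qed

lemma causal_le_refl: "p \<in> topspace X \<Longrightarrow> causal_le p p"
  by (simp add: causal_le_def)

lemma causal_le_trans: "causal_le p q \<Longrightarrow> causal_le q r \<Longrightarrow> causal_le p r"
  unfolding causal_le_iff_rtranclp by auto

lemma subset_J_plus: "W \<subseteq> topspace X \<Longrightarrow> W \<subseteq> J_plus W"
  unfolding J_plus_def using causal_le_refl by blast

lemma subset_J_minus: "W \<subseteq> topspace X \<Longrightarrow> W \<subseteq> J_minus W"
  unfolding J_minus_def using causal_le_refl by blast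

text \<open>Causality of a curve built in a chart becomes two inequalities for the coordinate
  metric. The strict one also forces the velocity to be nonzero, as the zero vector has product 0
  with \<open>T\<close>.\<close>

lemma causal_segment_chart_inv:
  fixes z z' :: "real \<Rightarrow> 'e"
  assumes c: "c \<in> A" and "s < t"
    and zO: "\<And>r. r \<in> {s..t} \<Longrightarrow> z r \<in> coord c ` dom_chart c"
    and der: "\<And>r. r \<in> {s..t} \<Longrightarrow> (z has_vector_derivative z' r) (at r within {s..t})"
    and cont: "continuous_on {s..t} z'"
    and caus: "\<And>r. r \<in> {s..t} \<Longrightarrow> metric_in_chart c (z r) (z' r) (z' r) \<le> 0"
    and fut: "\<And>r. r \<in> {s..t} \<Longrightarrow> metric_in_chart c (z r) (z' r) (T (chart_inv c (z r)) c) < 0"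
  shows "causal_segment (chart_inv c \<circ> z) s t"
  unfolding causal_segment_def
proof (intro conjI[OF _ ballI])
  show "C1_curve (chart_inv c \<circ> z) s t"
    by (rule C1_curve_chart_inv[OF c \<open>s < t\<close> zO der cont])
  fix r assume r: "r \<in> {s..t}"
  let ?p = "chart_inv c (z r)" and ?v = "velocity (chart_inv c \<circ> z) {s..t} r"
  have v: "?v = chart_vector c ?p (z' r)"
    by (rule velocity_chart_inv[OF c \<open>s < t\<close> zO der cont r])
  have p: "?p \<in> dom_chart c" using zO[OF r] by simp
  have Tp: "T ?p = chart_vector c ?p (T ?p c)"
    using dom_chart_subset[OF c] p
    by (intro tangent_eq_chart_vector[OF orientation_tangent c p]) auto
  have "future_directed ?p ?v"
    using fut[OF r] Tp unfolding future_directed_def v metric_in_chart_def by simp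
  moreover have "?v \<noteq> (\<lambda>_. 0)"
  proof
    assume "?v = (\<lambda>_. 0)"
    then have "g ?p ?v (T ?p) = metric_in_chart c (z r) 0 (T ?p c)"
      using metric_eq_metric_in_chart[OF c p, of ?v "T ?p"] v chart_vector_tangent[OF c p, of "z' r"]
        chart_vector_tangent[OF c p, of "T ?p c"] Tp zO[OF r] by simp
    also have "\<dots> = 0"
      using bilinear_lzero[OF bilinear_metric_in_chart[OF c zO[OF r]]] .
    finally show False
      using \<open>future_directed ?p ?v\<close> by (simp add: future_directed_def)
  qed
  ultimately show "causal_vector ((chart_inv c \<circ> z) r) ?v \<and> future_directed ((chart_inv c \<circ> z) r) ?v"
    using caus[OF r] chart_vector_tangent[OF c p]
    unfolding causal_vector_def v metric_in_chart_def by simp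
qed

subsection \<open>Openness of the causal cones\<close>

text \<open>The displacement \<open>D\<close> changes \<open>g(\<gamma>', \<gamma>')\<close> by \<open>O(\<bar>D\<bar>)\<close>, as the metric is Lipschitz, while
  adding \<open>D' = l u\<close> with \<open>u\<close> timelike lowers it by at least a multiple of \<open>l\<close>. Hence the
  perturbed curve stays causal when \<open>K \<bar>D\<bar> \<le> l\<close> and \<open>l\<close> is small.\<close>

lemma causal_segment_perturbation:
  assumes \<gamma>: "causal_segment \<gamma> a b" and t0: "t0 \<in> {a..b}"
  obtains c \<delta> r K u where "c \<in> A" "\<delta> > 0" "r > 0" "K > 0"
    "\<And>t. t \<in> {a..b} \<Longrightarrow> \<bar>t - t0\<bar> < \<delta> \<Longrightarrow> \<gamma> t \<in> dom_chart c"
    "\<And>s t D l. a \<le> s \<Longrightarrow> s < t \<Longrightarrow> t \<le> b \<Longrightarrow> \<bar>s - t0\<bar> < \<delta> \<Longrightarrow> \<bar>t - t0\<bar> < \<delta> \<Longrightarrow>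
       (\<And>x. x \<in> {s..t} \<Longrightarrow> (D has_vector_derivative l x *\<^sub>R u) (at x within {s..t})) \<Longrightarrow>
       continuous_on {s..t} l \<Longrightarrow>
       (\<And>x. x \<in> {s..t} \<Longrightarrow> K * norm (D x) \<le> l x \<and> l x < r) \<Longrightarrow>
       causal_le (chart_inv c (coord c (\<gamma> s) + D s)) (chart_inv c (coord c (\<gamma> t) + D t))"
proof -
  have ab: "a < b" using causal_segment_less[OF \<gamma>] .
  have C1: "C1_curve \<gamma> a b" using \<gamma> by (simp add: causal_segment_def)
  obtain c where c: "c \<in> A" "\<gamma> t0 \<in> dom_chart c"
    using causal_segment_in_topspace[OF \<gamma> t0] chart_cover by blast
  let ?O = "coord c ` dom_chart c" and ?M = "metric_in_chart c"
  define x where "x = coord c \<circ> \<gamma>"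
  define x' where "x' t = velocity \<gamma> {a..b} t c" for t
  \<comment> \<open>Constant in the coordinates, unlike the field \<open>T\<close>, so that
    \<open>D' = l u\<close> integrates explicitly; timelike at \<open>\<gamma> t0\<close>, and
    nearby by continuity.\<close>
  define u where "u = T (\<gamma> t0) c"
  let ?Tc = "\<lambda>y. T (chart_inv c y) c"
  have openO: "open ?O" using chart_image_open[OF c(1)] .
  have xO: "x t \<in> ?O" if "\<gamma> t \<in> dom_chart c" for t using that by (simp add: x_def)
  have T_tangent: "T p \<in> tangent_space p" if "p \<in> dom_chart c" for p
    using orientation_tangent dom_chart_subset[OF c(1)] that by blast
  have vel: "velocity \<gamma> {a..b} t \<in> tangent_space (\<gamma> t)"
    "g (\<gamma> t) (velocity \<gamma> {a..b} t) (velocity \<gamma> {a..b} t) \<le> 0"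
    "g (\<gamma> t) (velocity \<gamma> {a..b} t) (T (\<gamma> t)) < 0" if "t \<in> {a..b}" for t
    using \<gamma> that by (auto simp: causal_segment_def causal_vector_def future_directed_def)
  have N1: "?M (x t0) (x' t0) u < 0"
    using vel(3)[OF t0] metric_eq_metric_in_chart[OF c vel(1)[OF t0] T_tangent[OF c(2)]]
    by (simp add: x_def x'_def u_def)
  have N2: "?M (x t0) u u < 0"
    using orientation_timelike[OF causal_segment_in_topspace[OF \<gamma> t0]]
      metric_eq_metric_in_chart[OF c T_tangent[OF c(2)] T_tangent[OF c(2)]]
    by (simp add: x_def u_def)
  \<comment> \<open>Half of the margin at \<open>t0\<close>, so that it persists for nearby points
    and velocities.\<close>
  define c0 where "c0 = - ?M (x t0) (x' t0) u / 2"
  have c0: "c0 > 0" using N1 by (simp add: c0_def)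

  let ?S = "?O \<times> (UNIV :: 'e set)"
  have openS: "open ?S" using openO by (intro open_Times) auto
  define Q where "Q =
    (?S \<inter> (\<lambda>q. ?M (fst q) (snd q) (?Tc (fst q))) -` {..<0}) \<inter>
    (?S \<inter> (\<lambda>q. ?M (fst q) (snd q) u) -` {..<- c0}) \<inter>
    (?S \<inter> (\<lambda>q. ?M (fst q) u u) -` {..<0})"
  have "open Q"
    unfolding Q_def
    by (intro open_Int continuous_open_preimage continuous_on_metric_in_chart[OF c(1)] openS
        continuous_intros continuous_on_compose2[OF continuous_on_orientation_in_chart[OF c(1)]]) auto
  moreover have "(x t0, x' t0) \<in> Q"
    using N1 N2 xO[OF c(2)] c by (auto simp: Q_def c0_def u_def x_def)
  ultimately obtain e where e: "e > 0" "ball (x t0, x' t0) e \<subseteq> Q"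
    by (meson openE)
  have near: "y \<in> ?O" "?M y v (?Tc y) < 0" "?M y v u < - c0" "?M y u u < 0"
    if "norm (y - x t0) < e / 2" "norm (v - x' t0) < e / 2" for y v
  proof -
    have "dist (x t0, x' t0) (y, v) \<le> dist (x t0) y + dist (x' t0) v"
      unfolding dist_Pair_Pair by (rule sqrt_sum_squares_le_sum) auto
    also have "\<dots> < e" using that by (simp add: dist_norm norm_minus_commute)
    finally have "(y, v) \<in> Q" using e by auto
    then show "y \<in> ?O" "?M y v (?Tc y) < 0" "?M y v u < - c0" "?M y u u < 0"
      unfolding Q_def by auto
  qed
  have "cball (x t0) (e / 4) \<subseteq> ?O"
  proof
    fix y assume "y \<in> cball (x t0) (e / 4)"
    then show "y \<in> ?O"
      using near(1)[of y "x' t0"] e(1) by (simp add: dist_norm norm_minus_commute)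
  qed
  then obtain L where L0: "L \<ge> 0" and L: "\<And>y z v. y \<in> cball (x t0) (e / 4) \<Longrightarrow>
      z \<in> cball (x t0) (e / 4) \<Longrightarrow> \<bar>?M y v v - ?M z v v\<bar> \<le> L * norm (y - z) * (norm v)\<^sup>2"
    using metric_in_chart_lipschitz[OF c(1)] by metis
  \<comment> \<open>\<open>V\<close> bounds the perturbed velocity. \<open>K\<close> is chosen so
    that the loss \<open>L * V\<^sup>2 * \<bar>D\<bar>\<close> equals
    \<open>2 * c0 * (K - 1) * \<bar>D\<bar>\<close>, which the gain \<open>2 * c0 * l\<close>
    covers. The summand 1 gives \<open>\<bar>D\<bar> \<le> l\<close>, so that \<open>l < r\<close>
    bounds \<open>D\<close> too; \<open>r\<close> keeps both \<open>D\<close> and \<open>l u\<close>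
    within \<open>e / 8\<close>.\<close>
  define V where "V = norm (x' t0) + e / 2"
  define K where "K = L * V\<^sup>2 / (2 * c0) + 1"
  define r where "r = e / 8 / (1 + norm u)"
  have K1: "K \<ge> 1" using L0 c0 by (simp add: K_def)
  have u1: "1 + norm u > 0" by (simp add: add_pos_nonneg)
  have r: "r > 0" "r * norm u \<le> e / 8" "r \<le> e / 8"
  proof -
    show "r > 0" using e(1) u1 by (simp add: r_def)
    have "r * (1 + norm u) = e / 8" using u1 r_def by (metis nonzero_eq_divide_eq less_irrefl)
    then have "r + r * norm u = e / 8" by (simp add: distrib_left)
    moreover have "r * norm u \<ge> 0" using \<open>r > 0\<close> by simp
    ultimately show "r * norm u \<le> e / 8" "r \<le> e / 8" using \<open>r > 0\<close> by linarith+
  qed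

  let ?W = "{p \<in> dom_chart c. coord c p \<in> ball (x t0) (e / 8)}"
  have "openin (top_of_set {a..b}) {t \<in> {a..b}. \<gamma> t \<in> ?W}"
    using openin_continuous_map_preimage[of "top_of_set {a..b}" X \<gamma> ?W]
      openin_coord_vimage[OF c(1), of "ball (x t0) (e / 8)"] C1
    by (simp add: C1_curve_def)
  moreover have "t0 \<in> {t \<in> {a..b}. \<gamma> t \<in> ?W}"
    using t0 c e(1) by (simp add: x_def)
  ultimately obtain d1 where d1: "d1 > 0"
      "\<And>t. t \<in> {a..b} \<Longrightarrow> dist t t0 < d1 \<Longrightarrow> \<gamma> t \<in> ?W"
    unfolding openin_euclidean_subtopology_iff by (smt (verit, best) mem_Collect_eq)
  have contx': "continuous_on {t \<in> {a..b}. \<gamma> t \<in> dom_chart c} x'"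
    using C1 c(1) unfolding C1_curve_def x'_def by blast
  have t0S: "t0 \<in> {t \<in> {a..b}. \<gamma> t \<in> dom_chart c}" and e8: "e / 8 > 0"
    using t0 c e(1) by auto
  \<comment> \<open>Outside the chart \<open>x'\<close> takes the default value 0, so its continuity
    is available only under the chart condition, which \<open>d1\<close> secures.\<close>
  obtain d2 where d2: "d2 > 0"
      "\<And>t. t \<in> {a..b} \<Longrightarrow> \<gamma> t \<in> dom_chart c \<Longrightarrow> dist t t0 < d2 \<Longrightarrow> dist (x' t) (x' t0) < e / 8"
    using contx'[unfolded continuous_on_iff, rule_format, OF t0S e8] by blast
  define \<delta> where "\<delta> = min d1 d2"
  have local: "\<gamma> t \<in> dom_chart c" "norm (x t - x t0) < e / 8" "norm (x' t - x' t0) < e / 8"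
    if "t \<in> {a..b}" "\<bar>t - t0\<bar> < \<delta>" for t
    using d1(2)[of t] d2(2)[of t] that
    by (auto simp: \<delta>_def x_def dist_norm norm_minus_commute)
  show thesis
  proof (rule that[of c \<delta> r K u])
    show "c \<in> A" "\<delta> > 0" "r > 0" "K > 0" using c d1 d2 r K1 by (auto simp: \<delta>_def)
    show "\<gamma> t \<in> dom_chart c" if "t \<in> {a..b}" "\<bar>t - t0\<bar> < \<delta>" for t
      using local(1)[OF that] .
    fix s t D l
    assume st: "a \<le> s" "s < t" "t \<le> b" "\<bar>s - t0\<bar> < \<delta>" "\<bar>t - t0\<bar> < \<delta>"
      and D: "\<And>x. x \<in> {s..t} \<Longrightarrow> (D has_vector_derivative l x *\<^sub>R u) (at x within {s..t})"
      and l: "continuous_on {s..t} l"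
      and bnd: "\<And>x. x \<in> {s..t} \<Longrightarrow> K * norm (D x) \<le> l x \<and> l x < r"
    define z where "z \<tau> = x \<tau> + D \<tau>" for \<tau>
    define z' where "z' \<tau> = x' \<tau> + l \<tau> *\<^sub>R u" for \<tau>
    have sub: "\<tau> \<in> {a..b}" "\<bar>\<tau> - t0\<bar> < \<delta>" if "\<tau> \<in> {s..t}" for \<tau>
      using that st by auto
    have der: "(z has_vector_derivative z' \<tau>) (at \<tau> within {s..t})" if \<tau>: "\<tau> \<in> {s..t}" for \<tau>
    proof -
      note loc = local(1)[OF sub[OF \<tau>]]
      have "x differentiable at \<tau> within {a..b}"
        using C1 c(1) loc sub[OF \<tau>] unfolding C1_curve_def x_def by blast
      then have "(x has_vector_derivative x' \<tau>) (at \<tau> within {a..b})"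
        using loc c(1) by (simp add: x'_def velocity_def x_def flip: vector_derivative_works)
      then have "(x has_vector_derivative x' \<tau>) (at \<tau> within {s..t})"
        by (rule has_vector_derivative_within_subset) (use st in auto)
      then show ?thesis
        unfolding z_def z'_def by (intro has_vector_derivative_add D[OF \<tau>])
    qed
    have contz': "continuous_on {s..t} z'"
      unfolding z'_def
      by (intro continuous_intros l continuous_on_subset[OF contx']) (use sub local(1) in blast)
    have pt: "z \<tau> \<in> ?O" "?M (z \<tau>) (z' \<tau>) (z' \<tau>) \<le> 0" "?M (z \<tau>) (z' \<tau>) (?Tc (z \<tau>)) < 0"
      if \<tau>: "\<tau> \<in> {s..t}" for \<tau>
    proof -
      note loc = local[OF sub[OF \<tau>]]
      have yO: "x \<tau> \<in> ?O" using xO loc by blast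
      have "1 * norm (D \<tau>) \<le> K * norm (D \<tau>)" using K1 by (intro mult_right_mono) auto
      then have Dl: "norm (D \<tau>) \<le> l \<tau>" and l0: "0 \<le> l \<tau>" and lr: "l \<tau> < r"
        using bnd[OF \<tau>] norm_ge_zero[of "D \<tau>"] by linarith+
      have De: "norm (D \<tau>) < e / 8" using Dl lr r(3) by linarith
      have "norm (l \<tau> *\<^sub>R u) \<le> r * norm u" using l0 lr by (simp add: mult_right_mono)
      then have lu: "norm (l \<tau> *\<^sub>R u) \<le> e / 8" using r(2) by linarith
      have zx: "norm (z \<tau> - x t0) < e / 4"
        using norm_triangle_ineq[of "x \<tau> - x t0" "D \<tau>"] De loc(2) by (simp add: z_def algebra_simps)
      have z'x: "norm (z' \<tau> - x' t0) < e / 2"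
        using norm_triangle_ineq[of "x' \<tau> - x' t0" "l \<tau> *\<^sub>R u"] lu loc(3) e(1)
        by (simp add: z'_def algebra_simps)
      have e42: "e / 4 < e / 2" "e / 8 < e / 2" using e(1) by auto
      show "z \<tau> \<in> ?O" "?M (z \<tau>) (z' \<tau>) (?Tc (z \<tau>)) < 0"
        using near(1,2)[of "z \<tau>" "z' \<tau>"] zx z'x e42 by linarith+
      \<comment> \<open>The loss: the metric is evaluated at the displaced point instead of on the
        curve.\<close>
      have "?M (z \<tau>) (z' \<tau>) (z' \<tau>) - ?M (x \<tau>) (z' \<tau>) (z' \<tau>) \<le>
          L * norm (z \<tau> - x \<tau>) * (norm (z' \<tau>))\<^sup>2"
        using L[of "z \<tau>" "x \<tau>" "z' \<tau>"] zx loc(2) e(1)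
        by (simp add: dist_norm norm_minus_commute)
      also have "\<dots> \<le> L * norm (D \<tau>) * V\<^sup>2"
        unfolding z_def V_def using L0 z'x norm_triangle_ineq2[of "z' \<tau>" "x' t0"]
        by (intro mult_mono power_mono) auto
      also have "\<dots> = (2 * c0) * ((K - 1) * norm (D \<tau>))"
        using c0 by (simp add: K_def)
      also have "\<dots> \<le> (2 * c0) * l \<tau>"
        using c0 bnd[OF \<tau>] by (intro mult_left_mono) (auto simp: algebra_simps add_increasing2 intro: order.trans)
      finally have step1: "?M (z \<tau>) (z' \<tau>) (z' \<tau>) \<le> ?M (x \<tau>) (z' \<tau>) (z' \<tau>) + 2 * c0 * l \<tau>"
        by simp
      note bil = bilinear_metric_in_chart[OF c(1) yO]
      \<comment> \<open>The gain: on the original curve the form expands exactly. The cross term is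
        at most \<open>- 2 * c0 * l\<close> and cancels the loss; the other two are nonpositive
        because the old velocity is causal and \<open>u\<close> is timelike.\<close>
      have "?M (x \<tau>) (z' \<tau>) (z' \<tau>) = ?M (x \<tau>) (x' \<tau>) (x' \<tau>)
          + 2 * (l \<tau> * ?M (x \<tau>) (x' \<tau>) u) + l \<tau> * l \<tau> * ?M (x \<tau>) u u"
        unfolding z'_def using metric_in_chart_commute[OF c(1) yO, of u "x' \<tau>"]
        by (simp add: bilinear_ladd[OF bil] bilinear_radd[OF bil] bilinear_lmul[OF bil]
            bilinear_rmul[OF bil] algebra_simps)
      moreover have "?M (x \<tau>) (x' \<tau>) (x' \<tau>) \<le> 0"
        using vel(2)[OF sub(1)[OF \<tau>]]
          metric_eq_metric_in_chart[OF c(1) loc(1) vel(1)[OF sub(1)[OF \<tau>]] vel(1)[OF sub(1)[OF \<tau>]]]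
        by (simp add: x_def x'_def)
      moreover have "l \<tau> * ?M (x \<tau>) (x' \<tau>) u \<le> l \<tau> * (- c0)"
        using near(3)[of "x \<tau>" "x' \<tau>"] loc e42 l0 by (intro mult_left_mono) auto
      moreover have "l \<tau> * l \<tau> * ?M (x \<tau>) u u \<le> 0"
        using near(4)[of "x \<tau>" "x' \<tau>"] loc e42 l0 by (intro mult_nonneg_nonpos) auto
      ultimately show "?M (z \<tau>) (z' \<tau>) (z' \<tau>) \<le> 0"
        using step1 by (simp add: algebra_simps)
    qed
    have "causal_segment (chart_inv c \<circ> z) s t"
      by (rule causal_segment_chart_inv[OF c(1) st(2) pt(1) der contz' pt(2,3)])
    then have seg: "causal_step (chart_inv c (z s)) (chart_inv c (z t))"
      unfolding causal_step_def by (metis comp_apply)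
    then have "causal_le (chart_inv c (z s)) (chart_inv c (z t))"
      unfolding causal_le_iff_rtranclp using causal_step_in_topspace by blast
    then show "causal_le (chart_inv c (coord c (\<gamma> s) + D s)) (chart_inv c (coord c (\<gamma> t) + D t))"
      by (simp add: z_def x_def)
  qed
qed

text \<open>A pointwise form of the openness of cones that, being reflexive and transitive, propagates
  along curves from arbitrarily short pieces.\<close>

definition openly_related :: "'a \<Rightarrow> 'a \<Rightarrow> bool" where
  "openly_related p q \<longleftrightarrow>
     (\<forall>W. openin X W \<and> p \<in> W \<longrightarrow> (\<exists>V. openin X V \<and> q \<in> V \<and> V \<subseteq> J_plus W)) \<and>
     (\<forall>W. openin X W \<and> q \<in> W \<longrightarrow> (\<exists>V. openin X V \<and> p \<in> V \<and> V \<subseteq> J_minus W))"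

lemma openly_related_refl: "openly_related p p"
  unfolding openly_related_def
proof (intro conjI allI impI; elim conjE)
  fix W assume "openin X W" "p \<in> W"
  then show "\<exists>V. openin X V \<and> p \<in> V \<and> V \<subseteq> J_plus W" "\<exists>V. openin X V \<and> p \<in> V \<and> V \<subseteq> J_minus W"
    by (intro exI[of _ W], simp add: openin_subset subset_J_plus subset_J_minus)+
qed

lemma J_plus_J_plus_subset: "V \<subseteq> J_plus W \<Longrightarrow> J_plus V \<subseteq> J_plus W"
  unfolding J_plus_def using causal_le_trans by blast

lemma J_minus_J_minus_subset: "V \<subseteq> J_minus W \<Longrightarrow> J_minus V \<subseteq> J_minus W"
  unfolding J_minus_def using causal_le_trans by blast

lemma openly_related_trans:
  assumes "openly_related p q" "openly_related q r"
  shows "openly_related p r"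
  unfolding openly_related_def
proof (intro conjI allI impI; elim conjE)
  fix W assume "openin X W" "p \<in> W"
  then obtain V where "openin X V" "q \<in> V" "V \<subseteq> J_plus W"
    using assms(1) unfolding openly_related_def by blast
  moreover obtain U where "openin X U" "r \<in> U" "U \<subseteq> J_plus V"
    using assms(2) calculation unfolding openly_related_def by blast
  ultimately show "\<exists>V. openin X V \<and> r \<in> V \<and> V \<subseteq> J_plus W"
    using J_plus_J_plus_subset[of V W] by (meson order.trans)
next
  fix W assume "openin X W" "r \<in> W"
  then obtain V where "openin X V" "q \<in> V" "V \<subseteq> J_minus W"
    using assms(2) unfolding openly_related_def by blast
  moreover obtain U where "openin X U" "p \<in> U" "U \<subseteq> J_minus V"
    using assms(1) calculation unfolding openly_related_def by blast
  ultimately show "\<exists>V. openin X V \<and> p \<in> V \<and> V \<subseteq> J_minus W"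
    using J_minus_J_minus_subset[of V W] by (meson order.trans)
qed

text \<open>Together with its counterpart below, translates between open sets of \<open>X\<close>
  and small coordinate displacements, the language of the perturbation lemma.\<close>

lemma chart_ball_neighbourhood:
  assumes "c \<in> A" "p \<in> dom_chart c" "\<epsilon> > 0"
  shows "\<exists>V. openin X V \<and> p \<in> V \<and>
    (\<forall>q\<in>V. \<exists>w. norm w < \<epsilon> \<and> q = chart_inv c (coord c p + w))"
proof (intro exI[of _ "{q \<in> dom_chart c. coord c q \<in> ball (coord c p) \<epsilon>}"] conjI ballI)
  show "openin X {q \<in> dom_chart c. coord c q \<in> ball (coord c p) \<epsilon>}"
    by (rule openin_coord_vimage[OF assms(1)]) simp
  fix q assume "q \<in> {q \<in> dom_chart c. coord c q \<in> ball (coord c p) \<epsilon>}"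
  then show "\<exists>w. norm w < \<epsilon> \<and> q = chart_inv c (coord c p + w)"
    using assms(1) by (intro exI[of _ "coord c q - coord c p"]) (simp add: dist_norm norm_minus_commute)
qed (use assms in auto)

text \<open>Since \<open>chart_inv\<close> is arbitrary outside the image of the chart, the ball has
  to fit into the image of \<open>W \<inter> dom_chart c\<close>.\<close>

lemma chart_inv_eventually_in:
  assumes "c \<in> A" "p \<in> dom_chart c" "openin X W" "p \<in> W"
  shows "\<exists>\<epsilon>>0. \<forall>w. norm w < \<epsilon> \<longrightarrow> chart_inv c (coord c p + w) \<in> W"
proof -
  have "open (coord c ` (W \<inter> dom_chart c))"
    using assms by (intro open_coord_image) (auto intro: chart_open)
  then obtain \<epsilon> where "\<epsilon> > 0" and \<epsilon>: "ball (coord c p) \<epsilon> \<subseteq> coord c ` (W \<inter> dom_chart c)"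
    using assms openE by blast
  have "chart_inv c (coord c p + w) \<in> W" if "norm w < \<epsilon>" for w
  proof -
    have "coord c p + w \<in> coord c ` (W \<inter> dom_chart c)"
      using \<epsilon> that by (auto simp: dist_norm subset_iff)
    then obtain q where "q \<in> W" "q \<in> dom_chart c" "coord c p + w = coord c q" by blast
    then show ?thesis using assms(1) by simp
  qed
  with \<open>\<epsilon> > 0\<close> show ?thesis by blast
qed

text \<open>Shaped for a bisection argument: every short parameter interval containing
  \<open>t0\<close> qualifies.\<close>

lemma openly_related_local:
  assumes \<gamma>: "causal_segment \<gamma> a b" and t0: "t0 \<in> {a..b}"
  shows "\<exists>d>0. \<forall>s t. a \<le> s \<and> s \<le> t0 \<and> t0 \<le> t \<and> t \<le> b \<and> t - s < d \<longrightarrow>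
    openly_related (\<gamma> s) (\<gamma> t)"
proof -
  obtain c \<delta> r K u where c: "c \<in> A" and pos: "\<delta> > 0" "r > 0" "K > 0"
    and dom: "\<And>t. t \<in> {a..b} \<Longrightarrow> \<bar>t - t0\<bar> < \<delta> \<Longrightarrow> \<gamma> t \<in> dom_chart c"
    and perturb: "\<And>s t D l. a \<le> s \<Longrightarrow> s < t \<Longrightarrow> t \<le> b \<Longrightarrow> \<bar>s - t0\<bar> < \<delta> \<Longrightarrow> \<bar>t - t0\<bar> < \<delta> \<Longrightarrow>
       (\<And>x. x \<in> {s..t} \<Longrightarrow> (D has_vector_derivative l x *\<^sub>R u) (at x within {s..t})) \<Longrightarrow>
       continuous_on {s..t} l \<Longrightarrow>
       (\<And>x. x \<in> {s..t} \<Longrightarrow> K * norm (D x) \<le> l x \<and> l x < r) \<Longrightarrow>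
       causal_le (chart_inv c (coord c (\<gamma> s) + D s)) (chart_inv c (coord c (\<gamma> t) + D t))"
    using causal_segment_perturbation[OF \<gamma> t0] by metis
  \<comment> \<open>The displacements used below solve \<open>D' = l u\<close> with \<open>l\<close> exponential in time at rate \<open>\<kappa>\<close>, which
    is what keeps \<open>K \<bar>D\<bar> \<le> l\<close>; \<open>w\<close> prescribes \<open>D\<close> at one end point.\<close>
  define \<kappa> where "\<kappa> = K * (1 + norm u)"
  have \<kappa>: "\<kappa> > 0" using pos by (simp add: \<kappa>_def add_pos_nonneg)
  have "openly_related (\<gamma> s) (\<gamma> t)"
    if st: "a \<le> s" "s \<le> t0" "t0 \<le> t" "t \<le> b" "t - s < \<delta>" for s t
  proof (cases "s = t")
    case True
    then show ?thesis by (simp add: openly_related_refl)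
  next
    case False
    then have "s < t" using st by linarith
    have small: "\<bar>s - t0\<bar> < \<delta>" "\<bar>t - t0\<bar> < \<delta>" using st by auto
    have ps: "\<gamma> s \<in> dom_chart c" and pt: "\<gamma> t \<in> dom_chart c"
      using dom small st by auto
    define E where "E = exp (\<kappa> * (t - s))"
    have E: "E \<ge> 1" using \<kappa> \<open>s < t\<close> by (simp add: E_def)
    have Ebound: "1 \<le> exp (\<kappa> * h) \<and> exp (\<kappa> * h) \<le> E" if "0 \<le> h" "h \<le> t - s" for h
      using that \<kappa> by (simp add: E_def mult_left_mono)
    \<comment> \<open>The factor \<open>1 + norm u\<close> in the displacement bound is exactly what
      separates \<open>\<kappa>\<close> from \<open>K\<close>. Replacing \<open>e\<close> by its
      maximum \<open>E\<close> turns \<open>l < r\<close> into a smallness condition on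
      \<open>w\<close> alone.\<close>
    have control: "K * norm D \<le> norm w * \<kappa> * e \<and> norm w * \<kappa> * e < r"
      if "norm D \<le> norm w * (1 + norm u) * e" "1 \<le> e" "e \<le> E" "norm w < r / (\<kappa> * E)"
      for D w :: 'e and e :: real
    proof
      have "K * norm D \<le> K * (norm w * (1 + norm u) * e)" using that pos by simp
      then show "K * norm D \<le> norm w * \<kappa> * e" by (simp add: \<kappa>_def mult_ac)
      have "norm w * \<kappa> * e \<le> norm w * (\<kappa> * E)" using that \<kappa> by (simp add: mult_left_mono mult.assoc)
      also have "\<dots> < r" using that \<kappa> E by (simp add: pos_less_divide_eq)
      finally show "norm w * \<kappa> * e < r" .
    qed
    \<comment> \<open>The later end is prescribed, \<open>D t = w\<close>. The exponential is
      therefore counted backwards from \<open>t\<close>, and the minus sign in \<open>D\<close>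
      makes \<open>D'\<close> a nonnegative multiple of \<open>u\<close>.\<close>
    have fwd: "causal_le (chart_inv c (coord c (\<gamma> s) + (w - (norm w * (E - 1)) *\<^sub>R u)))
        (chart_inv c (coord c (\<gamma> t) + w))" if w: "norm w < r / (\<kappa> * E)" for w
    proof -
      define D where "D x = w - (norm w * (exp (\<kappa> * (t - x)) - 1)) *\<^sub>R u" for x
      define l where "l x = norm w * \<kappa> * exp (\<kappa> * (t - x))" for x
      have "causal_le (chart_inv c (coord c (\<gamma> s) + D s)) (chart_inv c (coord c (\<gamma> t) + D t))"
      proof (rule perturb[of s t D l, OF st(1) \<open>s < t\<close> st(4) small])
        show "(D has_vector_derivative l x *\<^sub>R u) (at x within {s..t})" for x
          unfolding D_def l_def
          by (auto intro!: derivative_eq_intros simp: algebra_simps)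
        show "continuous_on {s..t} l" unfolding l_def by (intro continuous_intros)
        show "K * norm (D x) \<le> l x \<and> l x < r" if "x \<in> {s..t}" for x
          using Ebound[of "t - x"] that w unfolding l_def D_def
          by (intro control exp_perturbation_bound) auto
      qed
      then show ?thesis by (simp add: D_def E_def)
    qed
    \<comment> \<open>The mirror image: the earlier end is prescribed, \<open>D s = w\<close>, and
      the exponential counts from \<open>s\<close>.\<close>
    have bwd: "causal_le (chart_inv c (coord c (\<gamma> s) + w))
        (chart_inv c (coord c (\<gamma> t) + (w + (norm w * (E - 1)) *\<^sub>R u)))"
      if w: "norm w < r / (\<kappa> * E)" for w
    proof -
      define D where "D x = w + (norm w * (exp (\<kappa> * (x - s)) - 1)) *\<^sub>R u" for x
      define l where "l x = norm w * \<kappa> * exp (\<kappa> * (x - s))" for x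
      have "causal_le (chart_inv c (coord c (\<gamma> s) + D s)) (chart_inv c (coord c (\<gamma> t) + D t))"
      proof (rule perturb[of s t D l, OF st(1) \<open>s < t\<close> st(4) small])
        show "(D has_vector_derivative l x *\<^sub>R u) (at x within {s..t})" for x
          unfolding D_def l_def
          by (auto intro!: derivative_eq_intros simp: algebra_simps)
        show "continuous_on {s..t} l" unfolding l_def by (intro continuous_intros)
        show "K * norm (D x) \<le> l x \<and> l x < r" if "x \<in> {s..t}" for x
          using Ebound[of "x - s"] that w unfolding l_def D_def
          by (intro control exp_perturbation_bound) auto
      qed
      then show ?thesis by (simp add: D_def E_def)
    qed
    \<comment> \<open>The displacement forced at the other end is at most
      \<open>(1 + norm u) * E\<close> times \<open>norm w\<close>, so it fits into any given ball
      once \<open>w\<close> is small.\<close>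
    have radius: "\<exists>\<epsilon>>0. \<forall>w::'e. norm w < \<epsilon> \<longrightarrow> norm w < r / (\<kappa> * E) \<and>
        norm (w + (norm w * (E - 1)) *\<^sub>R u) < \<eta> \<and> norm (w - (norm w * (E - 1)) *\<^sub>R u) < \<eta>"
      if "\<eta> > 0" for \<eta> :: real
    proof (intro exI conjI allI impI)
      define C where "C = (1 + norm u) * E"
      have C: "C > 0" using E by (simp add: C_def add_pos_nonneg)
      show "min (r / (\<kappa> * E)) (\<eta> / C) > 0" using pos \<kappa> E C that by simp
      fix w :: 'e assume w: "norm w < min (r / (\<kappa> * E)) (\<eta> / C)"
      then show "norm w < r / (\<kappa> * E)" by simp
      have "norm w * C < \<eta>" using w C by (simp add: pos_less_divide_eq)
      then show "norm (w + (norm w * (E - 1)) *\<^sub>R u) < \<eta>" "norm (w - (norm w * (E - 1)) *\<^sub>R u) < \<eta>"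
        using exp_perturbation_bound[OF E, of w u] by (simp_all add: C_def mult.assoc)
    qed
    show ?thesis
      unfolding openly_related_def
    proof (intro conjI allI impI; elim conjE)
      fix W assume W: "openin X W" "\<gamma> s \<in> W"
      obtain \<eta> where "\<eta> > 0"
        and \<eta>: "\<And>w. norm w < \<eta> \<Longrightarrow> chart_inv c (coord c (\<gamma> s) + w) \<in> W"
        using chart_inv_eventually_in[OF c ps W] by blast
      obtain \<epsilon> where "\<epsilon> > 0" and \<epsilon>: "\<And>w::'e. norm w < \<epsilon> \<Longrightarrow> norm w < r / (\<kappa> * E)"
        "\<And>w. norm w < \<epsilon> \<Longrightarrow> norm (w - (norm w * (E - 1)) *\<^sub>R u) < \<eta>"
        using radius[OF \<open>\<eta> > 0\<close>] by blast
      have hit: "chart_inv c (coord c (\<gamma> t) + w) \<in> J_plus W" if "norm w < \<epsilon>" for w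
        using fwd[OF \<epsilon>(1)[OF that]] \<eta>[OF \<epsilon>(2)[OF that]] unfolding J_plus_def by blast
      obtain V where "openin X V" "\<gamma> t \<in> V"
        and V: "\<And>q. q \<in> V \<Longrightarrow> \<exists>w. norm w < \<epsilon> \<and> q = chart_inv c (coord c (\<gamma> t) + w)"
        using chart_ball_neighbourhood[OF c pt \<open>\<epsilon> > 0\<close>] by metis
      moreover have "V \<subseteq> J_plus W"
      proof
        fix q assume "q \<in> V"
        then obtain w where "norm w < \<epsilon>" "q = chart_inv c (coord c (\<gamma> t) + w)"
          using V by blast
        then show "q \<in> J_plus W" using hit by simp
      qed
      ultimately show "\<exists>V. openin X V \<and> \<gamma> t \<in> V \<and> V \<subseteq> J_plus W" by blast
    next
      fix W assume W: "openin X W" "\<gamma> t \<in> W"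
      obtain \<eta> where "\<eta> > 0"
        and \<eta>: "\<And>w. norm w < \<eta> \<Longrightarrow> chart_inv c (coord c (\<gamma> t) + w) \<in> W"
        using chart_inv_eventually_in[OF c pt W] by blast
      obtain \<epsilon> where "\<epsilon> > 0" and \<epsilon>: "\<And>w::'e. norm w < \<epsilon> \<Longrightarrow> norm w < r / (\<kappa> * E)"
        "\<And>w. norm w < \<epsilon> \<Longrightarrow> norm (w + (norm w * (E - 1)) *\<^sub>R u) < \<eta>"
        using radius[OF \<open>\<eta> > 0\<close>] by blast
      have hit: "chart_inv c (coord c (\<gamma> s) + w) \<in> J_minus W" if "norm w < \<epsilon>" for w
        using bwd[OF \<epsilon>(1)[OF that]] \<eta>[OF \<epsilon>(2)[OF that]] unfolding J_minus_def by blast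
      obtain V where "openin X V" "\<gamma> s \<in> V"
        and V: "\<And>q. q \<in> V \<Longrightarrow> \<exists>w. norm w < \<epsilon> \<and> q = chart_inv c (coord c (\<gamma> s) + w)"
        using chart_ball_neighbourhood[OF c ps \<open>\<epsilon> > 0\<close>] by metis
      moreover have "V \<subseteq> J_minus W"
      proof
        fix q assume "q \<in> V"
        then obtain w where "norm w < \<epsilon>" "q = chart_inv c (coord c (\<gamma> s) + w)"
          using V by blast
        then show "q \<in> J_minus W" using hit by simp
      qed
      ultimately show "\<exists>V. openin X V \<and> \<gamma> s \<in> V \<and> V \<subseteq> J_minus W" by blast
    qed
  qed
  with pos(1) show ?thesis by blast
qed

text \<open>Compactness of the parameter interval, in the form of bisection: a transitive relation
  that holds on all short intervals around each parameter holds between the end points.\<close>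

lemma causal_step_openly_related:
  assumes "causal_step p q"
  shows "openly_related p q"
proof -
  obtain \<gamma> a b where \<gamma>: "causal_segment \<gamma> a b" and ends: "\<gamma> a = p" "\<gamma> b = q"
    using assms unfolding causal_step_def by blast
  have "a \<le> b" using causal_segment_less[OF \<gamma>] by simp
  \<comment> \<open>The guard confines the relation to \<open>{a..b}\<close>, as the short intervals
    in \<open>Bolzano\<close> may stick out of it.\<close>
  then have "a \<le> a \<and> b \<le> b \<longrightarrow> openly_related (\<gamma> a) (\<gamma> b)"
  proof (induction rule: Bolzano[where P="\<lambda>s t. a \<le> s \<and> t \<le> b \<longrightarrow> openly_related (\<gamma> s) (\<gamma> t)"])
    case (trans s r t)
    then show ?case using openly_related_trans[of "\<gamma> s" "\<gamma> r" "\<gamma> t"] by auto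
  next
    case (local t0)
    then show ?case using openly_related_local[OF \<gamma>, of t0] by fastforce
  qed
  then show ?thesis using ends by simp
qed

lemma causal_le_openly_related:
  assumes "causal_le p q"
  shows "openly_related p q"
proof -
  have "causal_step\<^sup>*\<^sup>* p q" using assms by (simp add: causal_le_iff_rtranclp)
  then show ?thesis
    by induction (auto intro: openly_related_refl openly_related_trans causal_step_openly_related)
qed

section \<open>Open cones and convexity of the ordered locale\<close>

lemma openin_J_plus:
  assumes "openin X U"
  shows "openin X (J_plus U)"
proof (subst openin_subopen, intro ballI)
  fix q assume "q \<in> J_plus U"
  then obtain p where "p \<in> U" "openly_related p q"
    unfolding J_plus_def using causal_le_openly_related by blast
  then show "\<exists>V. openin X V \<and> q \<in> V \<and> V \<subseteq> J_plus U"
    using assms unfolding openly_related_def by blast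
qed

lemma openin_J_minus:
  assumes "openin X U"
  shows "openin X (J_minus U)"
proof (subst openin_subopen, intro ballI)
  fix q assume "q \<in> J_minus U"
  then obtain p where "p \<in> U" "openly_related q p"
    unfolding J_minus_def using causal_le_openly_related by blast
  then show "\<exists>V. openin X V \<and> q \<in> V \<and> V \<subseteq> J_minus U"
    using assms unfolding openly_related_def by blast
qed

text \<open>Openness makes \<open>J_plus U\<close> itself a member of the union, and the largest
  one. The remaining half of \<open>Loc_le\<close> follows from
  \<open>U \<subseteq> J_plus U \<subseteq> J_minus (J_plus U)\<close>.\<close>

lemma up_cone_Loc_le:
  assumes "openin X U"
  shows "up_cone X Loc_le U = J_plus U"
proof
  show "up_cone X Loc_le U \<subseteq> J_plus U"
    unfolding up_cone_def Loc_le_def by blast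
  have "Loc_le U (J_plus U)"
    using assms openin_J_plus[OF assms] subset_J_plus[OF openin_subset[OF assms]]
      subset_J_minus[OF openin_subset[OF openin_J_plus[OF assms]]]
    unfolding Loc_le_def by auto
  then show "J_plus U \<subseteq> up_cone X Loc_le U"
    unfolding up_cone_def Loc_le_def by blast
qed

lemma down_cone_Loc_le:
  assumes "openin X U"
  shows "down_cone X Loc_le U = J_minus U"
proof
  show "down_cone X Loc_le U \<subseteq> J_minus U"
    unfolding down_cone_def Loc_le_def by blast
  have "Loc_le (J_minus U) U"
    using assms openin_J_minus[OF assms] subset_J_minus[OF openin_subset[OF assms]]
      subset_J_plus[OF openin_subset[OF openin_J_minus[OF assms]]]
    unfolding Loc_le_def by auto
  then show "J_minus U \<subseteq> down_cone X Loc_le U"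
    unfolding down_cone_def Loc_le_def by blast
qed

text \<open>Reflexivity puts \<open>U\<close> inside both cones in any case; the content of the
  equation is the opposite inclusion.\<close>

lemma causally_convex_iff:
  assumes "U \<subseteq> topspace X"
  shows "causally_convex U \<longleftrightarrow> U = J_plus U \<inter> J_minus U"
proof
  assume "causally_convex U"
  then show "U = J_plus U \<inter> J_minus U"
    using subset_J_plus[OF assms] subset_J_minus[OF assms]
    unfolding causally_convex_def J_plus_def J_minus_def by blast
next
  assume U: "U = J_plus U \<inter> J_minus U"
  have "z \<in> J_plus U \<inter> J_minus U" if "a \<in> U" "b \<in> U" "causal_le a z" "causal_le z b" for a b z
    using that unfolding J_plus_def J_minus_def by blast
  then show "causally_convex U"
    using U unfolding causally_convex_def by blast
qed

lemma strongly_causal_iff_convex: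
  "strongly_causal \<longleftrightarrow> convex_ordered_locale X Loc_le"
proof -
  \<comment> \<open>The cones are known only for open \<open>U\<close>; \<open>conj_cong\<close>
    makes that openness available on the right of the conjunction.\<close>
  have "(\<lambda>U. openin X U \<and> U = up_cone X Loc_le U \<inter> down_cone X Loc_le U) =
      (\<lambda>U. openin X U \<and> causally_convex U)"
    by (intro ext conj_cong refl)
      (simp add: up_cone_Loc_le down_cone_Loc_le causally_convex_iff openin_subset)
  then have "convex_ordered_locale X Loc_le \<longleftrightarrow>
      openin X = arbitrary union_of (\<lambda>U. openin X U \<and> causally_convex U)"
    by (simp add: convex_ordered_locale_def)
  also have "\<dots> \<longleftrightarrow> strongly_causal"
  proof
    assume eq: "openin X = arbitrary union_of (\<lambda>U. openin X U \<and> causally_convex U)"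
    show strongly_causal
      unfolding strongly_causal_def
    proof (intro ballI allI impI)
      fix x V assume "openin X V \<and> x \<in> V"
      then have "(arbitrary union_of (\<lambda>U. openin X U \<and> causally_convex U)) V" "x \<in> V"
        using eq by auto
      then show "\<exists>U. openin X U \<and> x \<in> U \<and> U \<subseteq> V \<and> causally_convex U"
        unfolding arbitrary_union_of_alt by blast
    qed
  next
    assume sc: strongly_causal
    show "openin X = arbitrary union_of (\<lambda>U. openin X U \<and> causally_convex U)"
    proof
      fix V
      show "openin X V = (arbitrary union_of (\<lambda>U. openin X U \<and> causally_convex U)) V"
        unfolding arbitrary_union_of_alt
      proof
        assume "openin X V"
        then show "\<forall>x\<in>V. \<exists>U. (openin X U \<and> causally_convex U) \<and> x \<in> U \<and> U \<subseteq> V"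
          using sc openin_subset[OF \<open>openin X V\<close>] unfolding strongly_causal_def
          by (meson subsetD)
      next
        assume "\<forall>x\<in>V. \<exists>U. (openin X U \<and> causally_convex U) \<and> x \<in> U \<and> U \<subseteq> V"
        then show "openin X V" by (subst openin_subopen) blast
      qed
    qed
  qed
  finally show ?thesis ..
qed

end

theorem corollary6p16:
  fixes X :: "'a topology"
    and A :: "('a, 'e::euclidean_space) chart set"
    and g :: "'a \<Rightarrow> (('a, 'e) chart \<Rightarrow> 'e) \<Rightarrow> (('a, 'e) chart \<Rightarrow> 'e) \<Rightarrow> real"
    and T :: "'a \<Rightarrow> (('a, 'e) chart \<Rightarrow> 'e)"
  assumes "smooth_spacetime X A g T"
  shows "smooth_spacetime.strongly_causal X A g T \<longleftrightarrow>
         convex_ordered_locale X (smooth_spacetime.Loc_le X A g T)"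
  using smooth_spacetime.strongly_causal_iff_convex[OF assms] .

end
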